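(* Let $X\subseteq L^1(I)$ be an ideal (respectively, let $(X,\|\cdot\|_X)$ be a Banach ideal in $L^1(I)$) such that every at most countable partition averages $X$. Then: I. Together with every function $X$ contains its orbit, and therefore, by the Calderón–Ryff theorem, $X$ is a majorant ideal. II. Respectively (in the case of a Banach ideal), if $\|E(\cdot|\mathcal{F})\|_{X\to X}\le 1$ for every at most countable partition $\mathcal{F}$, then $(X,\|\cdot\|_X)$ is a strongly majorant ideal.
   Context: $I=(0,1]$ with the Lebesgue $\sigma$-algebra $\Lambda$ and Lebesgue measure $\lambda$; functions are real-valued and identified a.e. For $f\in L^1(I)$, $f^*$ is the non-increasing right-continuous function on $I$ equimeasurable with $|f|$, and $f^{**}(t)=\frac1t\int_0^t f^*d\lambda$. Write $y\prec x$ if $y^{**}\le x^{**}$ on $I$. An at most countable partition is the $\sigma$-subalgebra (containing all null sets) generated by a finite or countable family of pairwise disjoint sets of positive measure with union $I$ (mod null sets); $E(\cdot|\mathcal{F})$ is conditional expectation, and $\mathcal{F}$ averages $X$ if $E(X|\mathcal{F})\subseteq X$. An ideal is a vector space $X$ with $L^\infty(I)\subseteq X\subseteq L^1(I)$ such that $x\in X$, $|y|\le|x|$ imply $y\in X$. A Banach ideal is an ideal with a complete norm such that $|y|\le|x|$ implies $\|y\|_X\le\|x\|_X$ and $\|x\|_{L^1(I)}\le\|x\|_X\le\|x\|_{L^\infty(I)}$ (the last inequality for $x\in L^\infty(I)$). A double stochastic operator is a positive linear $T:L^1(I)\to L^1(I)$ with $T(L^\infty(I))\subseteq L^\infty(I)$,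 $T\mathbf 1=\mathbf 1$ and $T^*\mathbf 1=\mathbf 1$, where $\mathbf 1$ is the constant function one and $T^*$ is the adjoint operator on $L^\infty(I)$; the orbit of $x\in L^1(I)$ is $\{Tx: T \text{ double stochastic}\}$. An ideal $X$ is majorant if it is an interpolation space between $L^1(I)$ and $L^\infty(I)$, i.e. $TX\subseteq X$ for every bounded linear $T:L^1(I)\to L^1(I)$ with $T(L^\infty(I))\subseteq L^\infty(I)$; by the Calderón–Ryff theorem this is equivalent to: $x\in X$, $y\in L^1(I)$, $y\prec x$ imply $y\in X$, and also to: $X$ contains the orbit of each of its elements. A Banach ideal is strongly majorant if $\|T\|_{X\to X}\le\max\{\|T\|_{L^1\to L^1},\|T\|_{L^\infty\to L^\infty}\}$ for all such $T$, equivalently if $x\in X$, $y\prec x$ imply $y\in X$ and $\|y\|_X\le\|x\|_X$. *)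

theory Defs
  imports "HOL-Probability.Probability"
begin

text \<open>
  Elements of function spaces over \<open>I = (0,1]\<close> are represented by functions on the real line,
  of which only the values on \<open>I\<close>, up to null sets, matter. Function spaces are sets of
  representatives closed under a.e. equality.
\<close>

abbreviation leb_I :: "real measure" where
  "leb_I \<equiv> lebesgue_on {0<..1}"

type_synonym fn = "real \<Rightarrow> real"

text \<open>Norms take values in the extended non-negative reals, so that suprema of norms always
  exist.\<close>

definition L1_norm :: "fn \<Rightarrow> ennreal" where
  "L1_norm f = (\<integral>\<^sup>+ t. ennreal \<bar>f t\<bar> \<partial>leb_I)"

definition Linf_norm :: "fn \<Rightarrow> ennreal" where
  "Linf_norm f = esssup leb_I (\<lambda>t. ennreal \<bar>f t\<bar>)"

definition L1 :: "fn set" where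
  "L1 = {f. integrable leb_I f}"

definition Linf :: "fn set" where
  "Linf = {f \<in> borel_measurable leb_I. Linf_norm f < \<infinity>}"

definition op_norm :: "fn set \<Rightarrow> (fn \<Rightarrow> ennreal) \<Rightarrow> (fn \<Rightarrow> fn) \<Rightarrow> ennreal" where
  "op_norm S \<nu> T = (SUP f\<in>{f \<in> S. \<nu> f \<le> 1}. \<nu> (T f))"


subsection \<open>Ideals and Banach ideals\<close>

text \<open>Since the defining implication of an ideal uses a.e. inequality, an ideal is in particular
  closed under a.e. equality; likewise the norm of a Banach ideal depends only on a.e. classes.\<close>

definition function_ideal :: "fn set \<Rightarrow> bool" where
  "function_ideal X \<longleftrightarrow>
     Linf \<subseteq> X \<and> X \<subseteq> L1 \<and>
     (\<forall>x\<in>X. \<forall>y\<in>X. (\<lambda>t. x t + y t) \<in> X) \<and>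
     (\<forall>x\<in>X. \<forall>c. (\<lambda>t. c * x t) \<in> X) \<and>
     (\<forall>x\<in>X. \<forall>y\<in>borel_measurable leb_I. (AE t in leb_I. \<bar>y t\<bar> \<le> \<bar>x t\<bar>) \<longrightarrow> y \<in> X)"

definition norm_on :: "fn set \<Rightarrow> (fn \<Rightarrow> real) \<Rightarrow> bool" where
  "norm_on X N \<longleftrightarrow>
     (\<forall>x\<in>X. 0 \<le> N x) \<and>
     (\<forall>x\<in>X. N x = 0 \<longleftrightarrow> (AE t in leb_I. x t = 0)) \<and>
     (\<forall>x\<in>X. \<forall>c. N (\<lambda>t. c * x t) = \<bar>c\<bar> * N x) \<and>
     (\<forall>x\<in>X. \<forall>y\<in>X. N (\<lambda>t. x t + y t) \<le> N x + N y)"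

definition complete_norm_on :: "fn set \<Rightarrow> (fn \<Rightarrow> real) \<Rightarrow> bool" where
  "complete_norm_on X N \<longleftrightarrow>
     (\<forall>u :: nat \<Rightarrow> fn. (\<forall>n. u n \<in> X) \<and>
        (\<forall>e>0. \<exists>K. \<forall>m\<ge>K. \<forall>n\<ge>K. N (\<lambda>t. u m t - u n t) < e) \<longrightarrow>
        (\<exists>x\<in>X. (\<lambda>n. N (\<lambda>t. u n t - x t)) \<longlonglongrightarrow> 0))"

definition banach_ideal :: "fn set \<Rightarrow> (fn \<Rightarrow> real) \<Rightarrow> bool" where
  "banach_ideal X N \<longleftrightarrow>
     function_ideal X \<and> norm_on X N \<and> complete_norm_on X N \<and>
     (\<forall>x\<in>X. \<forall>y\<in>X. (AE t in leb_I. \<bar>y t\<bar> \<le> \<bar>x t\<bar>) \<longrightarrow> N y \<le> N x) \<and>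
     (\<forall>x\<in>X. L1_norm x \<le> ennreal (N x)) \<and>
     (\<forall>x\<in>Linf. ennreal (N x) \<le> Linf_norm x)"


subsection \<open>Partitions and averaging\<close>

text \<open>The \<open>\<sigma>\<close>-subalgebra is represented, as usual for \<^const>\<open>real_cond_exp\<close>, by a measure of
  which only the space and the measurable sets are relevant.\<close>

definition countable_partition :: "real measure \<Rightarrow> bool" where
  "countable_partition F \<longleftrightarrow>
     (\<exists>P. countable P \<and> disjoint P \<and>
          (\<forall>A\<in>P. A \<in> sets leb_I \<and> 0 < emeasure leb_I A) \<and>
          space leb_I - \<Union>P \<in> null_sets leb_I \<and>
          F = sigma (space leb_I) (P \<union> null_sets leb_I))"

definition averages :: "real measure \<Rightarrow> fn set \<Rightarrow> bool" where
  "averages F X \<longleftrightarrow> real_cond_exp leb_I F ` X \<subseteq> X"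


subsection \<open>Operators, orbits, majorant ideals\<close>

definition linear_L1 :: "(fn \<Rightarrow> fn) \<Rightarrow> bool" where
  "linear_L1 T \<longleftrightarrow>
     T ` L1 \<subseteq> L1 \<and>
     (\<forall>f\<in>L1. \<forall>g\<in>L1. (AE t in leb_I. f t = g t) \<longrightarrow> (AE t in leb_I. T f t = T g t)) \<and>
     (\<forall>f\<in>L1. \<forall>g\<in>L1. AE t in leb_I. T (\<lambda>s. f s + g s) t = T f t + T g t) \<and>
     (\<forall>f\<in>L1. \<forall>c. AE t in leb_I. T (\<lambda>s. c * f s) t = c * T f t)"

definition bounded_linear_L1 :: "(fn \<Rightarrow> fn) \<Rightarrow> bool" where
  "bounded_linear_L1 T \<longleftrightarrow> linear_L1 T \<and> op_norm L1 L1_norm T < \<infinity>"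

definition L1_Linf_operator :: "(fn \<Rightarrow> fn) \<Rightarrow> bool" where
  "L1_Linf_operator T \<longleftrightarrow> bounded_linear_L1 T \<and> T ` Linf \<subseteq> Linf"

text \<open>\<open>adjoint_value T g h\<close> says \<open>T\<^sup>* g = h\<close>, where \<open>T\<^sup>*\<close> is the adjoint acting on \<^const>\<open>Linf\<close>,
  the dual of \<^const>\<open>L1\<close>; such an \<open>h\<close> is unique up to a.e. equality.\<close>

definition adjoint_value :: "(fn \<Rightarrow> fn) \<Rightarrow> fn \<Rightarrow> fn \<Rightarrow> bool" where
  "adjoint_value T g h \<longleftrightarrow>
     g \<in> Linf \<and> h \<in> Linf \<and>
     (\<forall>f\<in>L1. (\<integral>t. T f t * g t \<partial>leb_I) = (\<integral>t. f t * h t \<partial>leb_I))"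

definition double_stochastic :: "(fn \<Rightarrow> fn) \<Rightarrow> bool" where
  "double_stochastic T \<longleftrightarrow>
     linear_L1 T \<and>
     (\<forall>f\<in>L1. (AE t in leb_I. 0 \<le> f t) \<longrightarrow> (AE t in leb_I. 0 \<le> T f t)) \<and>
     T ` Linf \<subseteq> Linf \<and>
     (AE t in leb_I. T (\<lambda>_. 1) t = 1) \<and>
     adjoint_value T (\<lambda>_. 1) (\<lambda>_. 1)"

definition orbit :: "fn \<Rightarrow> fn set" where
  "orbit x = {T x | T. double_stochastic T}"

definition majorant_ideal :: "fn set \<Rightarrow> bool" where
  "majorant_ideal X \<longleftrightarrow>
     function_ideal X \<and> (\<forall>T. L1_Linf_operator T \<longrightarrow> T ` X \<subseteq> X)"

text \<open>Invariance of \<open>X\<close> under the operators is part of the notion, as it is presupposed by the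
  operator norm on \<open>X\<close>.\<close>

definition strongly_majorant_ideal :: "fn set \<Rightarrow> (fn \<Rightarrow> real) \<Rightarrow> bool" where
  "strongly_majorant_ideal X N \<longleftrightarrow>
     banach_ideal X N \<and> majorant_ideal X \<and>
     (\<forall>T. L1_Linf_operator T \<longrightarrow>
        op_norm X (\<lambda>x. ennreal (N x)) T \<le> max (op_norm L1 L1_norm T) (op_norm Linf Linf_norm T))"

end

theory Submission
  imports Defs
begin

text \<open>
  The theorem rests on a single assertion: let \<open>C\<close> be a solid set of integrable functions which is
  stable under averaging over countable partitions, and let \<open>T\<close> be a linear operator of norm at most
  \<open>M\<close> on both \<^const>\<open>L1\<close> and \<^const>\<open>Linf\<close>; then \<open>x \<in> C\<close> implies \<open>T x / M \<in> C\<close> (lemma \<open>operator_image\<close>).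
  Taking \<open>C = X\<close> shows that \<open>X\<close> is majorant; taking for \<open>C\<close> the functions in \<open>X\<close> of norm at most \<open>N x\<close>
  gives the norm estimate. Double stochastic operators are among the operators considered, whence the
  statement on orbits.

  Up to a factor close to 1, both \<open>x\<close> and \<open>\<bar>T x\<bar>\<close> are step functions with countably many values, on sets
  \<open>A n\<close> and \<open>B m\<close> say. The two norm bounds say that the amounts which \<open>T\<close> moves from \<open>A n\<close> to \<open>B m\<close>,
  divided by \<open>M\<close>, form a matrix with row and column sums at most the measures of the sets. So \<open>T x / M\<close>
  is dominated by a function obtained in two steps: distribute the values of \<open>x\<close> over the sets \<open>B m\<close>,
  keeping the measure of the set where each value is taken, and then average over the \<open>B m\<close>. The
  second step is an averaging over a partition. The point is that the first, a rearrangement, can also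
  be achieved by averagings, with arbitrarily small loss (lemma \<open>transport_equimeasurable\<close>).

  Averaging a warm and a cold set of equal measure transfers only half of the heat. But if both are
  divided into many small pieces and the pieces are brought into contact pairwise in counter-current
  order, nearly all heat is transferred (lemma \<open>heat_sum_lower\<close>). The pieces of all levels are averaged
  in parallel, so countably many levels need no more steps than one; the number of steps depends
  only on the loss.

  For the majorant property one also needs that an operator which is bounded on \<^const>\<open>L1\<close> and maps
  \<^const>\<open>Linf\<close> into itself is bounded on \<^const>\<open>Linf\<close> (lemma \<open>automatic_Linf_bound\<close>).

  Throughout, a countable partition is given by a label: a measurable function on the interval with
  values in a countable type, whose level sets are the blocks.
\<close>

section \<open>Labels with prescribed distribution\<close>

lemma prob_space_leb_I: "prob_space leb_I"
  by (rule prob_spaceI) (simp add: emeasure_restrict_space)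

interpretation leb: prob_space leb_I
  by (rule prob_space_leb_I)

text \<open>Keeping \<open>space leb_I\<close> folded makes sets of the form \<open>{t \<in> space leb_I. \<dots>}\<close> recognisable to
  the simplifier.\<close>

declare space_restrict_space2 [simp del] space_lebesgue_on [simp del]

lemma label_sets [measurable]:
  assumes "\<rho> \<in> leb_I \<rightarrow>\<^sub>M count_space UNIV"
  shows "{t\<in>space leb_I. \<rho> t \<in> S} \<in> sets leb_I"
  using assms by (rule measurable_sets_Collect) auto

text \<open>
  Lebesgue measure has no atoms: the distribution function \<open>\<phi> t\<close> of the measure restricted to \<open>B\<close>
  is continuous, so it attains every partial sum of \<open>w\<close>, and the intervals between the points where
  it does so cut \<open>B\<close> into pieces of the prescribed measures.
\<close>

lemma split_set:
  assumes B: "B \<in> sets leb_I"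
    and w: "\<And>n. 0 \<le> w n" "w sums measure leb_I B"
  shows "\<exists>\<sigma> \<in> leb_I \<rightarrow>\<^sub>M count_space UNIV.
           \<forall>n::nat. measure leb_I (B \<inter> {t\<in>space leb_I. \<sigma> t = n}) = w n"
proof -
  define \<phi> where "\<phi> = (\<lambda>t. measure leb_I (B \<inter> {..t}))"
  have Bsub: "B \<subseteq> {0<..1}"
    using sets.sets_into_space[OF B] by (simp add: space_restrict_space)
  have meas [measurable]: "B \<inter> {..t} \<in> sets leb_I" "B \<inter> {s<..t} \<in> sets leb_I" for s t :: real
    using B Bsub by (auto simp: sets_restrict_space_iff)
  have \<phi>diff: "\<phi> t - \<phi> s = measure leb_I (B \<inter> {s<..t})" if "s \<le> t" for s t
  proof -
    have "B \<inter> {..t} = (B \<inter> {..s}) \<union> (B \<inter> {s<..t})" using that by auto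
    then show ?thesis
      unfolding \<phi>_def using meas by (subst \<open>B \<inter> {..t} = _\<close>, subst leb.finite_measure_Union) auto
  qed
  have \<phi>bound: "measure leb_I (B \<inter> {s<..t}) \<le> t - s" if "s \<le> t" for s t
  proof -
    have "measure leb_I (B \<inter> {s<..t}) = measure lebesgue (B \<inter> {s<..t})"
      using Bsub by (subst measure_restrict_space) auto
    also have "\<dots> \<le> measure lebesgue {s<..t}"
    proof (rule measure_mono_fmeasurable)
      show "{s<..t} \<in> lmeasurable"
        using that by (simp add: fmeasurable_def)
    qed (use meas(2)[of s t] in \<open>auto simp: sets_restrict_space_iff\<close>)
    also have "\<dots> = t - s" using that by simp
    finally show ?thesis .
  qed
  have "\<bar>\<phi> t - \<phi> s\<bar> \<le> \<bar>t - s\<bar>" for s t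
    using \<phi>diff[of s t] \<phi>diff[of t s] \<phi>bound[of s t] \<phi>bound[of t s]
      measure_nonneg[of leb_I "B \<inter> {s<..t}"] measure_nonneg[of leb_I "B \<inter> {t<..s}"]
    by linarith
  then have cont: "continuous_on {0..1} \<phi>"
    unfolding continuous_on_iff dist_real_def
    using order_le_less_trans by blast
  have ends: "\<phi> 0 = 0" "\<phi> 1 = measure leb_I B"
  proof -
    have "B \<inter> {..0} = {}" "B \<inter> {..1} = B" using Bsub by auto
    then show "\<phi> 0 = 0" "\<phi> 1 = measure leb_I B" by (auto simp: \<phi>_def)
  qed
  define s where "s = (\<lambda>n. \<Sum>k<n. w k)"
  have s_mono: "s m \<le> s n" if "m \<le> n" for m n
    unfolding s_def using that w(1) by (intro sum_mono2) auto
  have s_le: "s n \<le> measure leb_I B" for n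
    unfolding s_def using w sum_le_suminf[of w "{..<n}"] by (auto simp: sums_iff)
  have "\<exists>\<tau>. \<forall>c\<in>{0..measure leb_I B}. \<phi> (\<tau> c) = c"
  proof (rule bchoice, intro ballI)
    fix c assume "c \<in> {0..measure leb_I B}"
    then show "\<exists>t. \<phi> t = c"
      using IVT'[of \<phi> 0 c 1] cont ends by auto
  qed
  then obtain \<tau> where \<tau>: "\<And>c. 0 \<le> c \<Longrightarrow> c \<le> measure leb_I B \<Longrightarrow> \<phi> (\<tau> c) = c"
    by (auto simp: Ball_def)
  \<comment> \<open>The cut points are values of one function of the partial sums, so they are
    ordered even where \<open>\<phi>\<close> is constant.\<close>
  define u where "u = (\<lambda>n. \<tau> (s n))"
  have \<phi>u: "\<phi> (u n) = s n" for n
    unfolding u_def using \<tau>[of "s n"] s_le s_mono[of 0 n] by (simp add: s_def)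
  have \<phi>mono: "\<phi> a \<le> \<phi> b" if "a \<le> b" for a b
    using \<phi>diff[OF that] measure_nonneg[of leb_I "B \<inter> {a<..b}"] by linarith
  have u_mono: "u m \<le> u n" if "m \<le> n" for m n
  proof (rule ccontr)
    assume *: "\<not> u m \<le> u n"
    then have "s n \<le> s m" using \<phi>mono[of "u n" "u m"] \<phi>u by simp
    then have "s n = s m" using s_mono[OF that] by simp
    then show False using * by (simp add: u_def)
  qed
  define J where "J = (\<lambda>n. {u n<..u (Suc n)})"
  have J_disj: "m = n" if "t \<in> J m" "t \<in> J n" for m n t
    using that u_mono[of "Suc m" n] u_mono[of "Suc n" m] unfolding J_def
    by (cases m n rule: linorder_cases) auto
  have J_meas: "measure leb_I (B \<inter> J n) = w n" for n
    using \<phi>diff[of "u n" "u (Suc n)"] u_mono[of n "Suc n"] \<phi>u[of n] \<phi>u[of "Suc n"]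
    by (simp add: J_def s_def)
  define R where "R = B - (\<Union>n. J n)"
  have [measurable]: "J n \<inter> space leb_I \<in> sets leb_I" for n
    using sets.Int[of "{u n<..u (Suc n)}" lebesgue "{0<..1}"]
    by (auto simp: J_def sets_restrict_space_iff space_restrict_space)
  have [measurable]: "B \<inter> J n \<in> sets leb_I" for n
    by (simp add: J_def)
  have R [measurable]: "R \<in> sets leb_I"
  proof -
    have "R = B - (\<Union>n. B \<inter> J n)" by (auto simp: R_def)
    moreover have "(\<Union>n. B \<inter> J n) \<in> sets leb_I"
      by (rule sets.countable_UN) auto
    ultimately show ?thesis using B by (simp only: sets.Diff)
  qed
  have R0: "measure leb_I R = 0"
  proof -
    have "(\<lambda>n. measure leb_I (B \<inter> J n)) sums measure leb_I (\<Union>n. B \<inter> J n)"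
      using J_disj by (intro leb.finite_measure_UNION) (auto simp: disjoint_family_on_def)
    then have "measure leb_I (\<Union>n. B \<inter> J n) = measure leb_I B"
      using w(2) by (simp add: J_meas sums_iff)
    moreover have "R = B - (\<Union>n. B \<inter> J n)" by (auto simp: R_def)
    moreover have "(\<Union>n. B \<inter> J n) \<in> sets leb_I"
      by (rule sets.countable_UN) auto
    ultimately show ?thesis
      using leb.finite_measure_Diff[OF B, of "\<Union>n. B \<inter> J n"] by (simp only:) auto
  qed
  define \<sigma> where "\<sigma> = (\<lambda>t. if \<exists>n. t \<in> J n then THE n. t \<in> J n else 0)"
  have \<sigma>J: "\<sigma> t = n" if "t \<in> J n" for t n
    using that J_disj unfolding \<sigma>_def by (auto intro!: the_equality)
  have pre: "\<sigma> -` {n} \<inter> space leb_I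
      = (J n \<inter> space leb_I) \<union> (if n = 0 then space leb_I - (\<Union>k. J k \<inter> space leb_I) else {})" for n
  proof -
    have "\<sigma> t = 0" if "\<And>n. t \<notin> J n" for t using that by (simp add: \<sigma>_def)
    then show ?thesis by (auto dest: \<sigma>J) (metis \<sigma>J less_irrefl)+
  qed
  have \<sigma>m: "\<sigma> \<in> leb_I \<rightarrow>\<^sub>M count_space UNIV"
  proof -
    have "(J n \<inter> space leb_I) \<union> (if n = 0 then space leb_I - (\<Union>k. J k \<inter> space leb_I) else {}) \<in> sets leb_I" for n
    proof -
      have "(\<Union>k. J k \<inter> space leb_I) \<in> sets leb_I"
        by (rule sets.countable_UN) auto
      then show ?thesis by (simp del: UN_simps)
    qed
    then show ?thesis
      unfolding measurable_count_space_eq2_countable by (simp only: pre) auto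
  qed
  have "measure leb_I (B \<inter> {t\<in>space leb_I. \<sigma> t = n}) = w n" for n
  proof -
    have m: "B \<inter> {t\<in>space leb_I. \<sigma> t = n} \<in> sets leb_I"
      using label_sets[OF \<sigma>m, of "{n}"] B by (simp del: space_restrict_space)
    have "measure leb_I (B \<inter> J n) \<le> measure leb_I (B \<inter> {t\<in>space leb_I. \<sigma> t = n})"
      using \<sigma>J Bsub m by (intro leb.finite_measure_mono) (auto simp: space_restrict_space)
    moreover have "measure leb_I (B \<inter> {t\<in>space leb_I. \<sigma> t = n}) \<le> measure leb_I ((B \<inter> J n) \<union> R)"
    proof (intro leb.finite_measure_mono)
      show "B \<inter> {t\<in>space leb_I. \<sigma> t = n} \<subseteq> (B \<inter> J n) \<union> R"
        using \<sigma>J by (auto simp: R_def)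
    qed auto
    moreover have "measure leb_I ((B \<inter> J n) \<union> R) \<le> measure leb_I (B \<inter> J n) + measure leb_I R"
      by (intro measure_Un_le) auto
    ultimately show ?thesis using R0 J_meas[of n] by linarith
  qed
  with \<sigma>m show ?thesis by (intro bexI[of _ \<sigma>]) auto
qed

lemma refine_label:
  fixes \<rho> :: "real \<Rightarrow> 'k::countable"
  assumes \<rho>: "\<rho> \<in> leb_I \<rightarrow>\<^sub>M count_space UNIV"
    and w: "\<And>r n. 0 \<le> w r n" "\<And>r. w r sums measure leb_I {t\<in>space leb_I. \<rho> t = r}"
  shows "\<exists>\<sigma> \<in> leb_I \<rightarrow>\<^sub>M count_space UNIV.
           \<forall>r. \<forall>n::nat. measure leb_I {t\<in>space leb_I. \<rho> t = r \<and> \<sigma> t = n} = w r n"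
proof -
  define Q where "Q = (\<lambda>r \<sigma>. \<sigma> \<in> leb_I \<rightarrow>\<^sub>M count_space UNIV \<and> 
      (\<forall>n::nat. measure leb_I ({t\<in>space leb_I. \<rho> t = r} \<inter> {t\<in>space leb_I. \<sigma> t = n}) = w r n))"
  have "\<exists>\<sigma>. Q r \<sigma>" for r
  proof -
    have "{t\<in>space leb_I. \<rho> t = r} \<in> sets leb_I"
      using label_sets[OF \<rho>, of "{r}"] by simp
    from split_set[where w="w r", OF this w]
    show ?thesis unfolding Bex_def Q_def .
  qed
  then obtain \<sigma> where "\<And>r. Q r (\<sigma> r)" by metis
  then have \<sigma>: "\<sigma> r \<in> leb_I \<rightarrow>\<^sub>M count_space UNIV"
    "measure leb_I ({t\<in>space leb_I. \<rho> t = r} \<inter> {t\<in>space leb_I. \<sigma> r t = n}) = w r n" for r n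
    by (simp_all add: Q_def)
  show ?thesis
  proof (rule bexI[of _ "\<lambda>t. \<sigma> (\<rho> t) t"], intro allI)
    show "(\<lambda>t. \<sigma> (\<rho> t) t) \<in> leb_I \<rightarrow>\<^sub>M count_space UNIV"
      by (rule measurable_compose_countable[OF \<sigma>(1) \<rho>])
    fix r and n :: nat
    have "{t\<in>space leb_I. \<rho> t = r \<and> \<sigma> (\<rho> t) t = n}
        = {t\<in>space leb_I. \<rho> t = r} \<inter> {t\<in>space leb_I. \<sigma> r t = n}" by auto
    then show "measure leb_I {t\<in>space leb_I. \<rho> t = r \<and> \<sigma> (\<rho> t) t = n} = w r n"
      by (simp only: \<sigma>(2))
  qed
qed

text \<open>
  The label \<open>h\<close> is uniformly distributed on \<open>{0..<L}\<close> and independent of \<open>\<rho>\<close>. It provides \<open>L\<close> disjoint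
  regions each of which looks to \<open>\<rho>\<close> like the whole interval, up to the factor \<open>1 / L\<close>.
\<close>

lemma uniform_label:
  fixes \<rho> :: "real \<Rightarrow> 'k::countable"
  assumes \<rho>: "\<rho> \<in> leb_I \<rightarrow>\<^sub>M count_space UNIV" and L: "0 < L"
  shows "\<exists>h \<in> leb_I \<rightarrow>\<^sub>M count_space UNIV. \<forall>S. \<forall>k<L.
           measure leb_I {t\<in>space leb_I. \<rho> t \<in> S \<and> h t = k}
             = measure leb_I {t\<in>space leb_I. \<rho> t \<in> S} / real L"
proof -
  let ?\<mu> = "\<lambda>r. measure leb_I {t\<in>space leb_I. \<rho> t = r}"
  have "(\<lambda>k. if k < L then ?\<mu> r / real L else 0) sums ?\<mu> r" for r
    using sums_If_finite_set[of "{..<L}" "\<lambda>_. ?\<mu> r / real L"] L by simp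
  then have "\<exists>h \<in> leb_I \<rightarrow>\<^sub>M count_space UNIV. \<forall>r. \<forall>k. measure leb_I {t\<in>space leb_I. \<rho> t = r \<and> h t = k}
      = (if k < L then ?\<mu> r / real L else 0)"
    by (intro refine_label[OF \<rho>]) auto
  then obtain h where h: "h \<in> leb_I \<rightarrow>\<^sub>M count_space UNIV"
    and hk: "\<And>r k. measure leb_I {t\<in>space leb_I. \<rho> t = r \<and> h t = k} = (if k < L then ?\<mu> r / real L else 0)"
    by blast
  have *: "measure leb_I {t\<in>space leb_I. \<rho> t \<in> S \<and> h t = k}
          = measure leb_I {t\<in>space leb_I. \<rho> t \<in> S} / real L" if k: "k < L" for S k
  proof -
    have m [measurable]: "{t\<in>space leb_I. \<rho> t = r} \<in> sets leb_I" "{t\<in>space leb_I. h t = k} \<in> sets leb_I" for r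
      using label_sets[OF \<rho>, of "{r}"] label_sets[OF h, of "{k}"] by simp_all
    have m2 [measurable]: "{t\<in>space leb_I. \<rho> t = r \<and> h t = k} \<in> sets leb_I" for r
    proof -
      have "{t\<in>space leb_I. \<rho> t = r \<and> h t = k} = {t\<in>space leb_I. \<rho> t = r} \<inter> {t\<in>space leb_I. h t = k}" by auto
      then show ?thesis using m by (simp only: sets.Int)
    qed
    have "emeasure leb_I {t\<in>space leb_I. \<rho> t \<in> S \<and> h t = k}
        = emeasure leb_I (\<Union>r\<in>S. {t\<in>space leb_I. \<rho> t = r \<and> h t = k})"
      by (rule arg_cong[where f="emeasure leb_I"]) auto
    also have "\<dots> = (\<integral>\<^sup>+r. emeasure leb_I {t\<in>space leb_I. \<rho> t = r \<and> h t = k} \<partial>count_space S)"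
      by (rule emeasure_UN_countable[OF m2]) (auto simp: disjoint_family_on_def)
    also have "\<dots> = (\<integral>\<^sup>+r. emeasure leb_I {t\<in>space leb_I. \<rho> t = r} * ennreal (1 / real L) \<partial>count_space S)"
    proof -
      have "emeasure leb_I {t\<in>space leb_I. \<rho> t = r \<and> h t = k}
          = emeasure leb_I {t\<in>space leb_I. \<rho> t = r} * ennreal (1 / real L)" for r
        using k by (simp add: leb.emeasure_eq_measure hk ennreal_mult''[symmetric])
      then show ?thesis by simp
    qed
    also have "\<dots> = (\<integral>\<^sup>+r. emeasure leb_I {t\<in>space leb_I. \<rho> t = r} \<partial>count_space S) * ennreal (1 / real L)"
      by (rule nn_integral_multc) auto
    also have "(\<integral>\<^sup>+r. emeasure leb_I {t\<in>space leb_I. \<rho> t = r} \<partial>count_space S)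
        = emeasure leb_I (\<Union>r\<in>S. {t\<in>space leb_I. \<rho> t = r})"
      by (rule emeasure_UN_countable[OF m(1), symmetric]) (auto simp: disjoint_family_on_def)
    also have "(\<Union>r\<in>S. {t\<in>space leb_I. \<rho> t = r}) = {t\<in>space leb_I. \<rho> t \<in> S}" by auto
    finally have "ennreal (measure leb_I {t\<in>space leb_I. \<rho> t \<in> S \<and> h t = k})
        = ennreal (measure leb_I {t\<in>space leb_I. \<rho> t \<in> S} * (1 / real L))"
      by (simp only: leb.emeasure_eq_measure ennreal_mult'' divide_nonneg_nonneg of_nat_0_le_iff zero_le_one)
    from arg_cong[OF this, of enn2real] show ?thesis
      by (simp only: enn2real_ennreal measure_nonneg mult_nonneg_nonneg divide_nonneg_nonneg
          of_nat_0_le_iff zero_le_one times_divide_eq_right mult_1_right)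
  qed
  show ?thesis
  proof (rule bexI[OF _ h], intro allI impI)
    fix S k assume "k < L"
    then show "measure leb_I {t\<in>space leb_I. \<rho> t \<in> S \<and> h t = k}
          = measure leb_I {t\<in>space leb_I. \<rho> t \<in> S} / real L"
      by (rule *)
  qed
qed

lemma pair_label:
  fixes \<rho> :: "real \<Rightarrow> 'k::countable" and \<sigma> :: "real \<Rightarrow> 'l::countable"
  assumes "\<rho> \<in> leb_I \<rightarrow>\<^sub>M count_space UNIV" "\<sigma> \<in> leb_I \<rightarrow>\<^sub>M count_space UNIV"
  shows "(\<lambda>t. (\<rho> t, \<sigma> t)) \<in> leb_I \<rightarrow>\<^sub>M count_space UNIV"
  unfolding measurable_count_space_eq2_countable
proof (intro conjI ballI)
  fix p :: "'k \<times> 'l"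
  have "(\<lambda>t. (\<rho> t, \<sigma> t)) -` {p} \<inter> space leb_I
      = {t\<in>space leb_I. \<rho> t \<in> {fst p}} \<inter> {t\<in>space leb_I. \<sigma> t \<in> {snd p}}"
    by (auto simp: prod_eq_iff)
  then show "(\<lambda>t. (\<rho> t, \<sigma> t)) -` {p} \<inter> space leb_I \<in> sets leb_I"
    using assms by (simp only: sets.Int label_sets)
qed auto

lemma label_total:
  fixes \<rho> :: "real \<Rightarrow> nat"
  assumes "\<rho> \<in> leb_I \<rightarrow>\<^sub>M count_space UNIV" "B \<in> sets leb_I"
  shows "(\<lambda>n. measure leb_I (B \<inter> {t\<in>space leb_I. \<rho> t = n})) sums measure leb_I B"
proof -
  have "(\<Union>n. B \<inter> {t\<in>space leb_I. \<rho> t = n}) = B"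
    using sets.sets_into_space[OF assms(2)] by auto
  moreover have "range (\<lambda>n. B \<inter> {t\<in>space leb_I. \<rho> t = n}) \<subseteq> sets leb_I"
    using label_sets[OF assms(1), of "{n}" for n] assms(2) by auto
  ultimately show ?thesis
    using leb.finite_measure_UNION[of "\<lambda>n. B \<inter> {t\<in>space leb_I. \<rho> t = n}"]
    by (auto simp: disjoint_family_on_def)
qed

section \<open>Averaging over a countable partition\<close>

lemma countable_partition_subalgebra:
  assumes "countable_partition F"
  shows "finite_measure_subalgebra leb_I F"
proof -
  obtain P where P: "\<forall>A\<in>P. A \<in> sets leb_I \<and> 0 < emeasure leb_I A"
    and F: "F = sigma (space leb_I) (P \<union> null_sets leb_I)"
    using assms unfolding countable_partition_def by blast
  have gen: "P \<union> null_sets leb_I \<subseteq> sets leb_I" using P by auto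
  then have gen': "P \<union> null_sets leb_I \<subseteq> Pow (space leb_I)"
    using sets.space_closed by blast
  have "subalgebra leb_I F"
    using gen' sets.sigma_sets_subset[OF gen] by (simp add: subalgebra_def F space_measure_of_conv)
  then show ?thesis by unfold_locales
qed

text \<open>
  On a level set of positive measure the conditional expectation is almost everywhere constant,
  because the level sets are atoms of the generated algebra; if it were below \<open>b k\<close> on such an atom,
  its integral there, which is that of \<open>g\<close>, would be too small. A lower bound is all one needs to
  know for concluding that a function belongs to a solid set.
\<close>

lemma cond_exp_label_lower:
  fixes \<rho> :: "real \<Rightarrow> 'k::countable"
  assumes \<rho>: "\<rho> \<in> leb_I \<rightarrow>\<^sub>M count_space UNIV"
    and g: "integrable leb_I g"
    and b: "\<And>k. b k * measure leb_I {t\<in>space leb_I. \<rho> t = k}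
              \<le> (\<integral>t\<in>{t\<in>space leb_I. \<rho> t = k}. g t \<partial>leb_I)"
  shows "\<exists>F. countable_partition F \<and> (AE t in leb_I. b (\<rho> t) \<le> real_cond_exp leb_I F g t)"
proof -
  define P where "P = (\<lambda>k. {t\<in>space leb_I. \<rho> t = k})"
  have P [measurable]: "P k \<in> sets leb_I" for k
    using label_sets[OF \<rho>, of "{k}"] by (simp add: P_def)
  define Q where "Q = {P k | k. 0 < emeasure leb_I (P k)}"
  define F where "F = sigma (space leb_I) (Q \<union> null_sets leb_I)"
  have gen: "Q \<union> null_sets leb_I \<subseteq> sets leb_I" by (auto simp: Q_def)
  have gen': "Q \<union> null_sets leb_I \<subseteq> Pow (space leb_I)"
    using gen sets.space_closed by blast
  have setsF: "sets F = sigma_sets (space leb_I) (Q \<union> null_sets leb_I)"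
    using gen' by (simp add: F_def)
  have sub: "sigma_sets (space leb_I) (Q \<union> null_sets leb_I) \<subseteq> sets leb_I"
    by (rule sets.sigma_sets_subset[OF gen])
  have spaceF: "space F = space leb_I"
    using gen' by (simp add: F_def space_measure_of_conv)
  have part: "countable_partition F"
    unfolding countable_partition_def
  proof (intro exI[of _ Q] conjI)
    have "Q = P ` {k. 0 < emeasure leb_I (P k)}" by (auto simp: Q_def)
    then show "countable Q" by simp
    show "disjoint Q" by (auto simp: Q_def P_def disjoint_def)
    show "\<forall>A\<in>Q. A \<in> sets leb_I \<and> 0 < emeasure leb_I A" by (auto simp: Q_def)
    show "space leb_I - \<Union>Q \<in> null_sets leb_I"
    proof (rule null_sets_subset)
      show "(\<Union>k\<in>{k. P k \<in> null_sets leb_I}. P k) \<in> null_sets leb_I"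
        by (rule null_sets_UN') auto
      show "space leb_I - \<Union>Q \<in> sets leb_I"
        using \<open>countable Q\<close> gen by (intro sets.Diff sets.top sets.countable_Union) auto
      show "space leb_I - \<Union>Q \<subseteq> (\<Union>k\<in>{k. P k \<in> null_sets leb_I}. P k)"
      proof
        fix t assume t: "t \<in> space leb_I - \<Union>Q"
        then have "t \<in> P (\<rho> t)" by (simp add: P_def)
        with t have "P (\<rho> t) \<notin> Q" by blast
        then have "P (\<rho> t) \<in> null_sets leb_I"
          using P[of "\<rho> t"] unfolding Q_def null_sets_def by (simp add: zero_less_iff_neq_zero)
        with \<open>t \<in> P (\<rho> t)\<close> show "t \<in> (\<Union>k\<in>{k. P k \<in> null_sets leb_I}. P k)" by blast
      qed
    qed
    show "F = sigma (space leb_I) (Q \<union> null_sets leb_I)" by (rule F_def)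
  qed
  interpret F: finite_measure_subalgebra leb_I F
    by (rule countable_partition_subalgebra[OF part])
  \<comment> \<open>The blocks are atoms of the generated algebra up to null sets.\<close>
  have atom: "A \<inter> P k \<in> null_sets leb_I \<or> P k - A \<in> null_sets leb_I"
    if "A \<in> sigma_sets (space leb_I) (Q \<union> null_sets leb_I)" for A k
    using that
  proof induction
    case (Basic a)
    then consider j where "a = P j" | "a \<in> null_sets leb_I" by (auto simp: Q_def)
    then show ?case
    proof cases
      case 1
      then have "P k - a = {} \<or> a \<inter> P k = {}" by (cases "j = k") (auto simp: P_def)
      then show ?thesis by (elim disjE) (simp_all only: null_sets.empty_sets simp_thms)
    next
      case 2
      then show ?thesis using null_set_Int2[OF 2 P] by blast
    qed
  next
    case Empty
    show ?case by simp
  next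
    case (Compl a)
    have "(space leb_I - a) \<inter> P k = P k - a" "P k - (space leb_I - a) = a \<inter> P k"
      by (auto simp: P_def)
    with Compl.IH show ?case by (simp only: disj_commute)
  next
    case (Union a)
    have m: "(\<Union>i. a i) \<in> sets leb_I"
      using Union.hyps sub by (intro sets.countable_UN) auto
    show ?case
    proof (cases "\<forall>i. a i \<inter> P k \<in> null_sets leb_I")
      case True
      then have "(\<Union>i. a i \<inter> P k) \<in> null_sets leb_I" by (intro null_sets_UN) auto
      then show ?thesis by simp
    next
      case False
      then obtain i where "P k - a i \<in> null_sets leb_I" using Union.IH by blast
      then have "P k - (\<Union>i. a i) \<in> null_sets leb_I"
        by (rule null_sets_subset) (use m in auto)
      then show ?thesis ..
    qed
  qed
  define y where "y = real_cond_exp leb_I F g"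
  have y: "integrable leb_I y"
    unfolding y_def by (rule F.real_cond_exp_int(1)[OF g])
  have "AE t in leb_I. t \<in> P k \<longrightarrow> b k \<le> y t" for k
  proof (cases "P k \<in> null_sets leb_I")
    case True
    then show ?thesis by (auto dest: AE_not_in)
  next
    case False
    define A where "A = {t\<in>space leb_I. y t < b k}"
    have PF: "P k \<in> sets F"
      using False unfolding setsF by (intro sigma_sets.Basic) (auto simp: Q_def null_sets_def zero_less_iff_neq_zero)
    have "A \<in> sets F"
    proof -
      have "y \<in> borel_measurable F" by (simp add: y_def)
      then have "{t\<in>space F. y t < b k} \<in> sets F" by measurable
      then show ?thesis by (simp add: A_def spaceF)
    qed
    then consider "A \<inter> P k \<in> null_sets leb_I" | "P k - A \<in> null_sets leb_I"
      using atom setsF by blast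
    then show ?thesis
    proof cases
      case 1
      from AE_not_in[OF this] AE_space show ?thesis
        by eventually_elim (auto simp: A_def)
    next
      case 2
      let ?f = "\<lambda>t. indicat_real (P k) t * (b k - y t)"
      have less: "AE t in leb_I. t \<in> P k \<longrightarrow> y t < b k"
        using AE_not_in[OF 2] by eventually_elim (auto simp: A_def)
      then have nonneg: "AE t in leb_I. 0 \<le> ?f t"
        by eventually_elim (auto simp: indicator_def)
      have int: "integrable leb_I (\<lambda>t. indicat_real (P k) t * y t)"
        using y by (rule integrable_mult_indicator[OF P, where 'b=real, simplified])
      have ind: "integrable leb_I (\<lambda>t. indicat_real (P k) t * b k)"
        by (intro integrable_mult_left integrable_real_indicator P) (simp add: leb.emeasure_eq_measure)
      have int': "integrable leb_I ?f"
        using int ind by (simp add: right_diff_distrib)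
      have "(\<integral>t. ?f t \<partial>leb_I) = b k * measure leb_I (P k) - (\<integral>t\<in>P k. y t \<partial>leb_I)"
        using int ind by (simp add: right_diff_distrib set_lebesgue_integral_def)
      also have "(\<integral>t\<in>P k. y t \<partial>leb_I) = (\<integral>t\<in>P k. g t \<partial>leb_I)"
        unfolding y_def by (rule F.real_cond_exp_intA[OF g PF, symmetric])
      also have "b k * measure leb_I (P k) - \<dots> \<le> 0" using b[of k] by (simp add: P_def)
      finally have "(\<integral>t. ?f t \<partial>leb_I) = 0"
        using integral_nonneg_AE[OF nonneg] by linarith
      then have "AE t in leb_I. ?f t = 0"
        using integral_nonneg_eq_0_iff_AE[OF int' nonneg] by simp
      with less have "AE t in leb_I. t \<notin> P k"
        by eventually_elim (auto simp: indicator_def)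
      then have False using False by (simp add: AE_iff_null_sets[OF P])
      then show ?thesis ..
    qed
  qed
  then have "AE t in leb_I. \<forall>k. t \<in> P k \<longrightarrow> b k \<le> y t"
    by (simp add: AE_all_countable)
  then have "AE t in leb_I. b (\<rho> t) \<le> y t"
    using AE_space by eventually_elim (auto simp: P_def)
  with part show ?thesis unfolding y_def by blast
qed

lemma set_integral_on_const:
  assumes A: "A \<in> sets leb_I" and f: "\<And>t. t \<in> A \<Longrightarrow> f t = v"
  shows "(\<integral>t\<in>A. f t \<partial>leb_I) = v * measure leb_I A"
proof -
  have "(\<integral>t\<in>A. f t \<partial>leb_I) = (\<integral>t\<in>A. v \<partial>leb_I)"
    using A f by (intro set_lebesgue_integral_cong) auto
  also have "\<dots> = v * measure leb_I A"
    using A sets.sets_into_space[OF A] by (simp add: set_lebesgue_integral_def Int_absorb2)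
  finally show ?thesis .
qed

text \<open>
  The closure properties shared by an averaged ideal \<open>X\<close> and, in the normed case, by the sets
  \<open>{z \<in> X. N z \<le> c}\<close>. Working with such a set \<open>C\<close> proves both parts at once. The last property,
  a consequence of homogeneity, absorbs the factors close to 1 lost on the way.
\<close>

locale averaging_stable =
  fixes C :: "fn set"
  assumes integrable: "x \<in> C \<Longrightarrow> integrable leb_I x"
    and solid: "\<lbrakk>x \<in> C; y \<in> borel_measurable leb_I; AE t in leb_I. \<bar>y t\<bar> \<le> \<bar>x t\<bar>\<rbrakk> \<Longrightarrow> y \<in> C"
    and avg: "\<lbrakk>x \<in> C; countable_partition F\<rbrakk> \<Longrightarrow> real_cond_exp leb_I F x \<in> C"
    and slack: "\<lbrakk>y \<in> borel_measurable leb_I; \<And>r. \<lbrakk>0 < r; r < 1\<rbrakk> \<Longrightarrow> (\<lambda>t. r * y t) \<in> C\<rbrakk> \<Longrightarrow> y \<in> C"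
begin

text \<open>
  The form in which averaging is applied: a step function whose value on each block is at most the
  mean of \<open>g\<close> over that block belongs to \<open>C\<close>.
\<close>

lemma block_average:
  fixes \<rho> :: "real \<Rightarrow> 'k::countable"
  assumes g: "g \<in> C"
    and \<rho>: "\<rho> \<in> leb_I \<rightarrow>\<^sub>M count_space UNIV"
    and b0: "\<And>k. 0 \<le> b k"
    and b: "\<And>k. b k * measure leb_I {t\<in>space leb_I. \<rho> t = k}
              \<le> (\<integral>t\<in>{t\<in>space leb_I. \<rho> t = k}. g t \<partial>leb_I)"
  shows "(\<lambda>t. b (\<rho> t)) \<in> C"
proof -
  obtain F where F: "countable_partition F" "AE t in leb_I. b (\<rho> t) \<le> real_cond_exp leb_I F g t"
    using cond_exp_label_lower[OF \<rho> integrable[OF g] b] by blast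
  show ?thesis
  proof (rule solid[OF avg[OF g F(1)]])
    show "(\<lambda>t. b (\<rho> t)) \<in> borel_measurable leb_I"
      using measurable_compose[OF \<rho>, of b borel] by simp
    show "AE t in leb_I. \<bar>b (\<rho> t)\<bar> \<le> \<bar>real_cond_exp leb_I F g t\<bar>"
      using F(2) by eventually_elim (use b0 in \<open>auto simp: abs_le_iff order_trans\<close>)
  qed
qed

end

section \<open>Counter-current exchange\<close>

text \<open>
  Temperatures in a counter-current heat exchanger. Sources of temperature 1 meet targets of
  temperature 0; at each meeting the two temperatures are replaced by their mean. Source \<open>i\<close> meets the
  targets \<open>0, 1, \<dots>, i - 1\<close> in this order, hottest first, and then target \<open>i\<close> comes into play at
  temperature 0. Here \<open>heat i j\<close> is the temperature of source \<open>i\<close> after it has met the first \<open>j\<close>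
  targets, so for \<open>j < i\<close> the value \<open>heat i (Suc j)\<close> is also that of target \<open>j\<close> after its meeting
  with source \<open>i\<close>.
\<close>

fun heat :: "nat \<Rightarrow> nat \<Rightarrow> real" where
  "heat i 0 = 1"
| "heat 0 (Suc j) = 0"
| "heat (Suc i) (Suc j) = (if i < j then 0 else (heat (Suc i) j + heat i (Suc j)) / 2)"

lemma heat_nonneg: "0 \<le> heat i j"
  by (induction i j rule: heat.induct) auto

lemma heat_above: "i < j \<Longrightarrow> heat i j = 0"
  by (cases "(i, j)" rule: heat.cases) auto

text \<open>
  The deficit \<open>1 - heat i j\<close> obeys a mean value recursion, which the quadratic on the right satisfies
  with equality (it is the squared position of a simple random walk, compensated by time); so it suffices to compare the two
  on the boundary \<open>j = 0\<close> and \<open>j = i + 1\<close>. Taking \<open>c = i - j\<close> makes the bound small as soon as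
  \<open>i - j\<close> is large compared with the square root of \<open>i\<close>.
\<close>

lemma heat_lower:
  assumes "j \<le> Suc i" "c > 0"
  shows "(1 - heat i j) * c\<^sup>2 \<le> (c - (real i - real j))\<^sup>2 + real i + real j"
  using assms
proof (induction i j rule: heat.induct)
  case (1 i)
  show ?case by simp
next
  case (2 j)
  then show ?case by (simp add: power2_eq_square algebra_simps)
next
  case (3 i j)
  show ?case
  proof (cases "i < j")
    case True
    then have j: "j = Suc i" using 3 by simp
    show ?thesis using 3(4) unfolding j by (simp add: power2_eq_square algebra_simps)
  next
    case False
    then have ih: "(1 - heat (Suc i) j) * c\<^sup>2 \<le> (c - (real (Suc i) - real j))\<^sup>2 + real (Suc i) + real j"
      "(1 - heat i (Suc j)) * c\<^sup>2 \<le> (c - (real i - real (Suc j)))\<^sup>2 + real i + real (Suc j)"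
      using 3 by auto
    have "(1 - heat (Suc i) (Suc j)) * c\<^sup>2
        = ((1 - heat (Suc i) j) * c\<^sup>2 + (1 - heat i (Suc j)) * c\<^sup>2) / 2"
      using False by (simp add: field_simps)
    also have "\<dots> \<le> ((c - (real (Suc i) - real j))\<^sup>2 + real (Suc i) + real j
          + ((c - (real i - real (Suc j)))\<^sup>2 + real i + real (Suc j))) / 2"
      by (intro divide_right_mono add_mono ih) simp
    also have "\<dots> = (c - (real (Suc i) - real (Suc j)))\<^sup>2 + real (Suc i) + real (Suc j)"
      by (simp add: power2_eq_square field_simps)
    finally show ?thesis .
  qed
qed

text \<open>
  With \<open>q\<^sup>3\<close> targets the final temperature is at least \<open>1 - 2 / q\<close> except for about \<open>q\<^sup>2\<close> targets, so
  the mean final temperature tends to 1: the exchanger transfers nearly all the heat, although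
  a single averaging would transfer only half of it.
\<close>

lemma heat_sum_lower:
  assumes q: "0 < q"
  shows "(1 - 4 / real q) * real (q^3) \<le> (\<Sum>k<q^3. heat (q^3 - 1) (Suc k))"
proof -
  define L where "L = q^3"
  have L0: "0 < L" using q by (simp add: L_def)
  have q2: "q^2 \<le> L" using q by (simp add: L_def power_increasing)
  have one: "1 - 2 / real q \<le> heat (L - 1) (Suc k)" if "k + q^2 + 2 \<le> L" for k
  proof -
    define c where "c = real (L - 1) - real (Suc k)"
    have c: "real q^2 \<le> c" using that by (simp add: c_def of_nat_diff flip: of_nat_power)
    have "real q ^ 2 > 0" using q by simp
    then have c0: "0 < c" using c by linarith
    have "(1 - heat (L - 1) (Suc k)) * c\<^sup>2 \<le> (c - c)\<^sup>2 + real (L - 1) + real (Suc k)"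
      unfolding c_def by (rule heat_lower) (use that c0 in \<open>auto simp: c_def\<close>)
    also have "\<dots> \<le> 2 * real L" using that by simp
    finally have 1: "(1 - heat (L - 1) (Suc k)) * c\<^sup>2 \<le> 2 * real L" .
    show ?thesis
    proof (cases "heat (L - 1) (Suc k) \<le> 1")
      case True
      have "(1 - heat (L - 1) (Suc k)) * (real q^2)\<^sup>2 \<le> (1 - heat (L - 1) (Suc k)) * c\<^sup>2"
        using True c by (intro mult_left_mono power_mono) auto
      with 1 have "(1 - heat (L - 1) (Suc k)) * real q ^ 4 \<le> 2 * real q ^ 3"
        by (simp add: L_def flip: power_mult)
      then have "(1 - heat (L - 1) (Suc k)) * real q * real q^3 \<le> 2 * real q ^ 3"
        by (simp add: power_numeral_reduce mult_ac)
      then have "(1 - heat (L - 1) (Suc k)) * real q \<le> 2" using q by simp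
      then show ?thesis using q by (simp add: field_simps)
    next
      case False
      moreover have "1 - 2 / real q \<le> 1" by simp
      ultimately show ?thesis by linarith
    qed
  qed
  show ?thesis
  proof (cases "q = 1")
    case True
    have "0 \<le> (\<Sum>k<q^3. heat (q^3 - 1) (Suc k))" by (intro sum_nonneg heat_nonneg)
    then show ?thesis using True by simp
  next
    case False
    then have q: "2 \<le> q" using q by simp
    define m where "m = L - q^2 - 1"
    have L2: "q^2 + 1 \<le> L"
    proof -
      have "q^2 * 2 \<le> q^2 * q" by (rule mult_le_mono2) (rule q)
      moreover have "1 \<le> q^2" using q by simp
      moreover have "L = q^2 * q" by (simp add: L_def power_numeral_reduce mult_ac)
      ultimately show ?thesis by linarith
    qed
    have m: "real m = real L - real q^2 - 1" using L2 by (simp add: m_def of_nat_diff)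
    have "(\<Sum>k<m. 1 - 2 / real q) \<le> (\<Sum>k<m. heat (L - 1) (Suc k))"
      by (rule sum_mono, rule one) (use L2 in \<open>auto simp: m_def\<close>)
    also have "\<dots> \<le> (\<Sum>k<L. heat (L - 1) (Suc k))"
      by (rule sum_mono2) (auto simp: m_def heat_nonneg)
    finally have "(real L - real q^2 - 1) * (1 - 2 / real q) \<le> (\<Sum>k<L. heat (L - 1) (Suc k))"
      by (simp add: m)
    moreover have "(1 - 4 / real q) * real L \<le> (real L - real q^2 - 1) * (1 - 2 / real q)"
    proof -
      have "real L = real q * real q^2" by (simp add: L_def power_numeral_reduce)
      then have eq: "(real L - real q^2 - 1) * (1 - 2 / real q) - (1 - 4 / real q) * real L
          = (real q^2 - 1) + 2 * real q + 2 / real q"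
        using q by (simp add: field_simps power2_eq_square)
      have "1 \<le> real q^2" using q by simp
      then have "0 \<le> (real q^2 - 1) + 2 * real q + 2 / real q" by simp
      then show ?thesis unfolding eq[symmetric] by (simp only: diff_ge_0_iff_ge)
    qed
    ultimately show ?thesis by (simp add: L_def)
  qed
qed

section \<open>Rearranging step functions by averagings\<close>

context averaging_stable begin

text \<open>
  Rearrangement invariance. The source and target sets of a level may overlap, so a direct exchange
  between them is impossible. Instead the interval is cut into \<open>L\<close> regions by a label \<open>h\<close> independent
  of the two arrangements. At stage \<open>i\<close> the regions below \<open>i\<close> are already in the arrangement \<open>pD\<close> and
  the others still in \<open>pA\<close>, so that the cells \<open>{p i = n, h = k}\<close> are disjoint and, for each level \<open>n\<close>,
  of equal measure. The source in region \<open>i\<close> gives off its heat to the targets in the regions before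
  it, simultaneously in all levels, whereupon the region is emptied and rearranged. As all levels move
  in parallel, the number of averagings depends only on the loss that is admitted. A final
  averaging over the target sets makes the temperature uniform.
\<close>

lemma transport_equimeasurable:
  fixes pA pD :: "real \<Rightarrow> nat"
  assumes pA [measurable]: "pA \<in> leb_I \<rightarrow>\<^sub>M count_space UNIV"
    and pD [measurable]: "pD \<in> leb_I \<rightarrow>\<^sub>M count_space UNIV"
    and a: "\<And>n. 0 \<le> a n" "a 0 = 0"
    and eq: "\<And>n. n \<noteq> 0 \<Longrightarrow> measure leb_I {t\<in>space leb_I. pA t = n} = measure leb_I {t\<in>space leb_I. pD t = n}"
    and start: "(\<lambda>t. a (pA t)) \<in> C"
  shows "(\<lambda>t. a (pD t)) \<in> C"
proof (rule slack)
  show "(\<lambda>t. a (pD t)) \<in> borel_measurable leb_I"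
    using measurable_compose[OF pD, of a borel] by simp
next
  fix r :: real assume r: "0 < r" "r < 1"
  obtain q :: nat where q: "4 / (1 - r) < real q" using reals_Archimedean2 by blast
  moreover have "0 < 4 / (1 - r)" using r by simp
  ultimately have q0: "0 < q" by linarith
  have rq: "r \<le> 1 - 4 / real q"
    using q q0 r by (simp add: field_simps)
  define L where "L = q^3"
  have L0: "0 < L" using q0 by (simp add: L_def)
  obtain h where h [measurable]: "h \<in> leb_I \<rightarrow>\<^sub>M count_space UNIV"
    and hS: "\<And>S k. k < L \<Longrightarrow> measure leb_I {t\<in>space leb_I. (pA t, pD t) \<in> S \<and> h t = k}
       = measure leb_I {t\<in>space leb_I. (pA t, pD t) \<in> S} / real L"
    using uniform_label[OF pair_label[OF pA pD] L0] by blast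
  define \<alpha> where "\<alpha> n = measure leb_I {t\<in>space leb_I. pD t = n}" for n
  define p where "p = (\<lambda>i t. if h t < i then pD t else pA t)"
  have p_label [measurable]: "p i \<in> leb_I \<rightarrow>\<^sub>M count_space UNIV" for i
    unfolding p_def by measurable
  have pm: "measure leb_I {t\<in>space leb_I. p i t = n \<and> h t = k} = \<alpha> n / real L"
    if "k < L" "n \<noteq> 0" for i n k
  proof (cases "k < i")
    case True
    then have "{t\<in>space leb_I. p i t = n \<and> h t = k} = {t\<in>space leb_I. (pA t, pD t) \<in> {x. snd x = n} \<and> h t = k}"
      by (auto simp: p_def)
    moreover have "{t\<in>space leb_I. (pA t, pD t) \<in> {x. snd x = n}} = {t\<in>space leb_I. pD t = n}" by auto
    ultimately show ?thesis by (simp only: hS[OF that(1)] \<alpha>_def)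
  next
    case False
    then have "{t\<in>space leb_I. p i t = n \<and> h t = k} = {t\<in>space leb_I. (pA t, pD t) \<in> {x. fst x = n} \<and> h t = k}"
      by (auto simp: p_def)
    moreover have "{t\<in>space leb_I. (pA t, pD t) \<in> {x. fst x = n}} = {t\<in>space leb_I. pA t = n}" by auto
    ultimately show ?thesis by (simp only: hS[OF that(1)] \<alpha>_def eq[OF that(2)])
  qed
  define cell where "cell = (\<lambda>i n k. {t\<in>space leb_I. p i t = n \<and> h t = k})"
  have cell [measurable]: "cell i n k \<in> sets leb_I" for i n k
    unfolding cell_def by measurable
  define state where "state = (\<lambda>i c t. a (p i t) * (c (h t) :: real))"
  have state0: "0 \<le> state i c t" if "\<And>k. 0 \<le> c k" for i c t
    using a that by (simp add: state_def)
  have cell_int: "(\<integral>t\<in>cell i n k. state i c t \<partial>leb_I) = a n * c k * measure leb_I (cell i n k)" for i c n k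
    by (rule set_integral_on_const) (auto simp: cell_def state_def)
  have mix: "state i (c(j := m, k := m)) \<in> C"
    if C: "state i c \<in> C" and jk: "j < L" "k < L" "j \<noteq> k" and c: "\<And>l. 0 \<le> c l"
      and m: "m = (c j + c k) / 2" for i c j k m
  proof -
    \<comment> \<open>Merging the regions \<open>j\<close> and \<open>k\<close> within each level; label \<open>(n, k)\<close> becomes empty.\<close>
    define \<rho> where "\<rho> = (\<lambda>t. (p i t, if h t = k then j else h t))"
    define c' where "c' = c(j := m, k := m)"
    define b where "b = (\<lambda>(n, l). a n * c' l)"
    have m0: "0 \<le> m" using c[of j] c[of k] m by simp
    have \<rho>: "\<rho> \<in> leb_I \<rightarrow>\<^sub>M count_space UNIV"
      unfolding \<rho>_def by (intro pair_label p_label) measurable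
    have "(\<lambda>t. b (\<rho> t)) \<in> C"
    proof (rule block_average[OF C \<rho>])
      show "0 \<le> b x" for x using a c m0 by (cases x) (simp add: b_def c'_def)
      fix x :: "nat \<times> nat"
      obtain n l where x: "x = (n, l)" by (cases x)
      let ?B = "{t\<in>space leb_I. \<rho> t = x}"
      show "b x * measure leb_I ?B \<le> (\<integral>t\<in>?B. state i c t \<partial>leb_I)"
      proof -
        consider "n = 0" | "l = k" | "n \<noteq> 0" "l = j" | "l \<noteq> k" "l \<noteq> j" by blast
        then show ?thesis
        proof cases
          case 1
          have "0 \<le> (\<integral>t\<in>?B. state i c t \<partial>leb_I)"
            using state0[OF c] by (simp add: set_lebesgue_integral_def)
          then show ?thesis using 1 by (simp add: x b_def a)
        next
          case 2
          then have "?B = {}" using jk by (auto simp: \<rho>_def x split: if_splits)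
          then show ?thesis by (simp only:) (simp add: set_lebesgue_integral_def)
        next
          case 3
          have B: "?B = cell i n j \<union> cell i n k"
            using 3 jk by (auto simp: \<rho>_def cell_def x)
          have disj: "cell i n j \<inter> cell i n k = {}" using jk by (auto simp: cell_def)
          have int: "set_integrable leb_I (cell i n l) (state i c)" for l
            using integrable_mult_indicator[OF cell integrable[OF C]]
            by (simp add: set_integrable_def)
          have "(\<integral>t\<in>?B. state i c t \<partial>leb_I)
              = a n * c j * measure leb_I (cell i n j) + a n * c k * measure leb_I (cell i n k)"
            unfolding B by (subst set_integral_Un[OF disj int int]) (simp only: cell_int)
          also have "\<dots> = a n * c' j * (\<alpha> n / L + \<alpha> n / L)"
            using 3 jk by (simp add: cell_def pm c'_def m algebra_simps)
          also have "\<alpha> n / L + \<alpha> n / L = measure leb_I ?B"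
            unfolding B using 3 jk by (subst leb.finite_measure_Union[OF _ _ disj]) (simp_all, simp add: cell_def pm)
          finally show ?thesis using 3 by (simp add: x b_def)
        next
          case 4
          then have B: "?B = cell i n l" by (auto simp: \<rho>_def cell_def x)
          show ?thesis unfolding B using 4 by (simp add: cell_int x b_def c'_def)
        qed
      qed
    qed
    also have "(\<lambda>t. b (\<rho> t)) = state i c'"
      by (auto simp: b_def \<rho>_def state_def c'_def)
    finally show ?thesis by (simp add: c'_def)
  qed
  \<comment> \<open>Region \<open>i\<close> changes its arrangement; at temperature 0 this alters the state only there,
    and only downwards.\<close>
  have advance: "state (Suc i) (c(i := 0)) \<in> C" if "state i c \<in> C" "\<And>l. 0 \<le> c l" for i c
  proof (rule solid[OF that(1)])
    have "(\<lambda>t. a (p (Suc i) t)) \<in> borel_measurable leb_I"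
      "(\<lambda>t. (c(i := 0)) (h t)) \<in> borel_measurable leb_I"
      using measurable_compose[OF p_label[of "Suc i"], of a borel]
        measurable_compose[OF h, of "c(i := 0)" borel] by simp_all
    then show "state (Suc i) (c(i := 0)) \<in> borel_measurable leb_I"
      unfolding state_def by (rule borel_measurable_times)
    have "\<bar>state (Suc i) (c(i := 0)) t\<bar> \<le> \<bar>state i c t\<bar>" for t
      by (cases "h t" i rule: linorder_cases) (auto simp: state_def p_def)
    then show "AE t in leb_I. \<bar>state (Suc i) (c(i := 0)) t\<bar> \<le> \<bar>state i c t\<bar>" by simp
  qed
  \<comment> \<open>\<open>vec i j\<close> lists the temperatures of the regions at stage \<open>i\<close> after \<open>j\<close> meetings: targets
    met by source \<open>i\<close>, targets still to be met, the source itself, and fresh sources.\<close>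
  define vec where "vec = (\<lambda>i j k. if k < j then heat i (Suc k) else if k < i then heat (i - 1) (Suc k)
      else if k = i then heat i j else 1)"
  have vec0: "0 \<le> vec i j k" for i j k by (simp add: vec_def heat_nonneg)
  have inner: "state i (vec i j) \<in> C" if "state i (vec i 0) \<in> C" "i < L" "j \<le> i" for i j
    using that(3)
  proof (induction j)
    case 0
    show ?case by (rule that(1))
  next
    case (Suc j)
    obtain i' where i': "i = Suc i'" "j \<le> i'" using Suc.prems by (cases i) auto
    have v: "vec i (Suc j) = (vec i j)(j := heat i (Suc j), i := heat i (Suc j))"
      using i' by (auto simp: vec_def fun_eq_iff)
    have m: "heat i (Suc j) = (vec i j j + vec i j i) / 2"
      using i' by (auto simp: vec_def)
    show ?case
      unfolding v by (rule mix[OF _ _ that(2) _ vec0 m]) (use Suc that(2) in auto)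
  qed
  have outer: "state i (vec i 0) \<in> C" if "i \<le> L" for i
    using that
  proof (induction i)
    case 0
    have "state 0 (vec 0 0) = (\<lambda>t. a (pA t))" by (auto simp: state_def vec_def p_def)
    then show ?case using start by simp
  next
    case (Suc i)
    have v: "vec (Suc i) 0 = (vec i i)(i := 0)"
      by (auto simp: vec_def fun_eq_iff heat_above simp del: heat.simps(3))
    show ?case
      unfolding v by (rule advance[OF inner vec0]) (use Suc in auto)
  qed
  define c where "c = vec L 0"
  have c: "state L c \<in> C" "\<And>k. 0 \<le> c k" using outer vec0 by (auto simp: c_def)
  have "(\<lambda>t. r * a (pD t)) \<in> C"
  proof (rule block_average[OF c(1) pD])
    show "0 \<le> r * a n" for n using r a by simp
    fix n
    let ?B = "{t\<in>space leb_I. pD t = n}"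
    show "r * a n * measure leb_I ?B \<le> (\<integral>t\<in>?B. state L c t \<partial>leb_I)"
    proof (cases "n = 0")
      case True
      have "0 \<le> (\<integral>t\<in>?B. state L c t \<partial>leb_I)"
        using state0[OF c(2)] by (simp add: set_lebesgue_integral_def)
      then show ?thesis using True by (simp add: a)
    next
      case False
      have B [measurable]: "?B \<in> sets leb_I" by measurable
      have ind1: "integrable leb_I (\<lambda>t. a n * c k * indicat_real (cell L n k) t)" for k
        by (intro integrable_mult_right integrable_real_indicator cell) (simp add: leb.emeasure_eq_measure)
      then have ind: "integrable leb_I (\<lambda>t. \<Sum>k<L. a n * c k * indicat_real (cell L n k) t)"
        by (rule Bochner_Integration.integrable_sum)
      have "r * real L \<le> (1 - 4 / real q) * real L" using rq by (intro mult_right_mono) auto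
      also have "\<dots> \<le> (\<Sum>k<L. c k)"
        using heat_sum_lower[OF q0] by (simp add: L_def c_def vec_def)
      finally have "r * real L * (a n * \<alpha> n / L) \<le> (\<Sum>k<L. c k) * (a n * \<alpha> n / L)"
        using a by (intro mult_right_mono) (auto simp: \<alpha>_def)
      then have "r * a n * measure leb_I ?B \<le> (\<Sum>k<L. a n * c k * (\<alpha> n / L))"
        using L0 by (simp add: \<alpha>_def sum_distrib_left sum_distrib_right sum_divide_distrib mult_ac)
      also have "\<dots> = (\<Sum>k<L. a n * c k * measure leb_I (cell L n k))"
        using False by (simp add: cell_def pm)
      also have "\<dots> = (\<integral>t. (\<Sum>k<L. a n * c k * indicat_real (cell L n k) t) \<partial>leb_I)"
        using ind1 sets.sets_into_space[OF cell]
        by (subst Bochner_Integration.integral_sum) (auto simp: Int_absorb2)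
      also have "\<dots> \<le> (\<integral>t. indicat_real ?B t * state L c t \<partial>leb_I)"
      proof (rule integral_mono)
        show "integrable leb_I (\<lambda>t. \<Sum>k<L. a n * c k * indicat_real (cell L n k) t)"
          by (rule ind)
        show "integrable leb_I (\<lambda>t. indicat_real ?B t * state L c t)"
          using integrable_mult_indicator[OF B integrable[OF c(1)]] by simp
        fix t assume t: "t \<in> space leb_I"
        show "(\<Sum>k<L. a n * c k * indicat_real (cell L n k) t) \<le> indicat_real ?B t * state L c t"
        proof (cases "h t < L \<and> pD t = n")
          case True
          then have "(\<Sum>k<L. a n * c k * indicat_real (cell L n k) t)
              = (\<Sum>k<L. if k = h t then a n * c k else 0)"
            using t by (intro sum.cong) (auto simp: cell_def p_def)
          then show ?thesis using True t by (simp add: state_def p_def)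
        next
          case False
          then have "(\<Sum>k<L. a n * c k * indicat_real (cell L n k) t) = 0"
            by (intro sum.neutral) (auto simp: cell_def p_def indicator_def split: if_splits)
          then show ?thesis using state0[OF c(2)] by simp
        qed
      qed
      finally show ?thesis by (simp add: set_lebesgue_integral_def)
    qed
  qed
  then show "(\<lambda>t. r * a (pD t)) \<in> C" .
qed

text \<open>
  If a target is smaller than its source, the superfluous part of the source is dropped first, that
  is, given the label 0.
\<close>

lemma transport:
  fixes pA pD :: "real \<Rightarrow> nat"
  assumes pA [measurable]: "pA \<in> leb_I \<rightarrow>\<^sub>M count_space UNIV"
    and pD [measurable]: "pD \<in> leb_I \<rightarrow>\<^sub>M count_space UNIV"
    and a: "\<And>n. 0 \<le> a n" "a 0 = 0"
    and le: "\<And>n. n \<noteq> 0 \<Longrightarrow> measure leb_I {t\<in>space leb_I. pD t = n} \<le> measure leb_I {t\<in>space leb_I. pA t = n}"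
    and start: "(\<lambda>t. a (pA t)) \<in> C"
  shows "(\<lambda>t. a (pD t)) \<in> C"
proof -
  define \<alpha> where "\<alpha> n = measure leb_I {t\<in>space leb_I. pA t = n}" for n
  define \<delta> where "\<delta> n = (if n = 0 then 0 else measure leb_I {t\<in>space leb_I. pD t = n})" for n
  define w where "w n k = (if k = 0 then \<alpha> n - \<delta> n else if k = 1 then \<delta> n else 0)" for n and k :: nat
  have w0: "0 \<le> w n k" for n k using le[of n] by (auto simp: w_def \<alpha>_def \<delta>_def)
  have w: "w n sums measure leb_I {t\<in>space leb_I. pA t = n}" for n
    using sums_finite[of "{0, 1}" "w n"] by (auto simp: w_def \<alpha>_def)
  obtain \<sigma> where \<sigma> [measurable]: "\<sigma> \<in> leb_I \<rightarrow>\<^sub>M count_space UNIV"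
    and \<sigma>w: "\<And>n k. measure leb_I {t\<in>space leb_I. pA t = n \<and> \<sigma> t = k} = w n k"
    using refine_label[OF pA w0 w] by blast
  define pA' where "pA' = (\<lambda>t. if \<sigma> t = 1 then pA t else 0)"
  have pA' [measurable]: "pA' \<in> leb_I \<rightarrow>\<^sub>M count_space UNIV"
    unfolding pA'_def by measurable
  show ?thesis
  proof (rule transport_equimeasurable[where a=a, OF pA' pD a])
    fix n :: nat assume n: "n \<noteq> 0"
    then have "{t\<in>space leb_I. pA' t = n} = {t\<in>space leb_I. pA t = n \<and> \<sigma> t = 1}"
      by (auto simp: pA'_def)
    then show "measure leb_I {t\<in>space leb_I. pA' t = n} = measure leb_I {t\<in>space leb_I. pD t = n}"
      using n by (simp add: \<sigma>w w_def \<delta>_def)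
  next
    show "(\<lambda>t. a (pA' t)) \<in> C"
    proof (rule solid[OF start])
      show "(\<lambda>t. a (pA' t)) \<in> borel_measurable leb_I"
        using measurable_compose[OF pA', of a borel] by simp
      show "AE t in leb_I. \<bar>a (pA' t)\<bar> \<le> \<bar>a (pA t)\<bar>"
        using a by (simp add: pA'_def)
    qed
  qed
qed

end

section \<open>Bounds for linear operators\<close>

lemma linear_L1_integrable:
  "\<lbrakk>linear_L1 T; integrable leb_I f\<rbrakk> \<Longrightarrow> integrable leb_I (T f)"
  by (auto simp: linear_L1_def L1_def)

lemma linear_L1_add:
  "\<lbrakk>linear_L1 T; integrable leb_I f; integrable leb_I g\<rbrakk>
    \<Longrightarrow> AE t in leb_I. T (\<lambda>s. f s + g s) t = T f t + T g t"
  by (auto simp: linear_L1_def L1_def)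

lemma linear_L1_scale:
  "\<lbrakk>linear_L1 T; integrable leb_I f\<rbrakk> \<Longrightarrow> AE t in leb_I. T (\<lambda>s. c * f s) t = c * T f t"
  by (auto simp: linear_L1_def L1_def)

lemma linear_L1_cong:
  "\<lbrakk>linear_L1 T; integrable leb_I f; integrable leb_I g; AE t in leb_I. f t = g t\<rbrakk>
    \<Longrightarrow> AE t in leb_I. T f t = T g t"
  by (auto simp: linear_L1_def L1_def)

lemma linear_L1_diff:
  assumes "linear_L1 T" "integrable leb_I f" "integrable leb_I g"
  shows "AE t in leb_I. T (\<lambda>s. f s - g s) t = T f t - T g t"
proof -
  have "AE t in leb_I. T (\<lambda>s. f s + (-1) * g s) t = T f t + T (\<lambda>s. (-1) * g s) t"
    using assms by (intro linear_L1_add) auto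
  then show ?thesis
    using linear_L1_scale[OF assms(1,3), of "-1"] by eventually_elim simp
qed

lemma L1_norm_integrable: "integrable leb_I f \<Longrightarrow> L1_norm f = ennreal (\<integral>t. \<bar>f t\<bar> \<partial>leb_I)"
  unfolding L1_norm_def by (rule nn_integral_eq_integral) auto

lemma L1_operator_bound:
  assumes T: "linear_L1 T" and c: "0 \<le> c" "op_norm L1 L1_norm T \<le> ennreal c"
    and f: "integrable leb_I f"
  shows "(\<integral>t. \<bar>T f t\<bar> \<partial>leb_I) \<le> c * (\<integral>t. \<bar>f t\<bar> \<partial>leb_I)"
proof -
  define n where "n = (\<integral>t. \<bar>f t\<bar> \<partial>leb_I)"
  have n0: "0 \<le> n" by (simp add: n_def)
  have Tf: "integrable leb_I (T f)" by (rule linear_L1_integrable[OF T f])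
  show ?thesis
  proof (cases "n = 0")
    case True
    then have "AE t in leb_I. \<bar>f t\<bar> = 0"
      unfolding n_def using f by (subst (asm) integral_nonneg_eq_0_iff_AE) auto
    then have "AE t in leb_I. f t = 0 * f t" by eventually_elim simp
    then have "AE t in leb_I. T f t = T (\<lambda>s. 0 * f s) t"
      using f by (intro linear_L1_cong[OF T]) auto
    with linear_L1_scale[OF T f, of 0] have "AE t in leb_I. \<bar>T f t\<bar> = 0"
      by eventually_elim simp
    then have "(\<integral>t. \<bar>T f t\<bar> \<partial>leb_I) = (\<integral>t. 0 \<partial>leb_I)"
      using Tf by (intro integral_cong_AE) auto
    then show ?thesis using True by (simp add: n_def)
  next
    case False
    then have n: "0 < n" using n0 by simp
    define g where "g = (\<lambda>s. (1 / n) * f s)"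
    have g: "integrable leb_I g" using f by (simp add: g_def)
    have Tg: "integrable leb_I (T g)" by (rule linear_L1_integrable[OF T g])
    have "(\<integral>t. \<bar>g t\<bar> \<partial>leb_I) = 1"
      using n by (simp add: g_def abs_mult n_def[symmetric])
    then have "L1_norm g \<le> 1" using L1_norm_integrable[OF g] by simp
    then have "L1_norm (T g) \<le> op_norm L1 L1_norm T"
      unfolding op_norm_def using g by (intro SUP_upper) (auto simp: L1_def)
    then have "L1_norm (T g) \<le> ennreal c" using c(2) by (rule order_trans)
    then have "(\<integral>t. \<bar>T g t\<bar> \<partial>leb_I) \<le> c" using L1_norm_integrable[OF Tg] c by simp
    also have "(\<integral>t. \<bar>T g t\<bar> \<partial>leb_I) = (\<integral>t. (1 / n) * \<bar>T f t\<bar> \<partial>leb_I)"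
    proof (rule integral_cong_AE)
      show "AE t in leb_I. \<bar>T g t\<bar> = (1 / n) * \<bar>T f t\<bar>"
        using linear_L1_scale[OF T f, of "1 / n"] unfolding g_def
        by eventually_elim (use n in \<open>simp add: abs_mult\<close>)
    qed (use Tg Tf in auto)
    also have "\<dots> = (1 / n) * (\<integral>t. \<bar>T f t\<bar> \<partial>leb_I)" by simp
    finally show ?thesis using n by (simp add: n_def[symmetric] field_simps)
  qed
qed

lemma Linf_iff:
  "f \<in> Linf \<longleftrightarrow> f \<in> borel_measurable leb_I \<and> (\<exists>c. AE t in leb_I. \<bar>f t\<bar> \<le> c)"
proof safe
  assume f: "f \<in> Linf"
  then show "f \<in> borel_measurable leb_I" by (simp add: Linf_def)
  have fin: "Linf_norm f < \<infinity>" using f by (simp add: Linf_def)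
  have "AE t in leb_I. \<bar>f t\<bar> \<le> enn2real (Linf_norm f)"
    using esssup_AE[where M = leb_I and f = "\<lambda>t. ennreal \<bar>f t\<bar>"]
  proof eventually_elim
    case (elim t)
    then have "ennreal \<bar>f t\<bar> \<le> Linf_norm f" by (simp add: Linf_norm_def)
    then have "enn2real (ennreal \<bar>f t\<bar>) \<le> enn2real (Linf_norm f)"
      using fin by (intro enn2real_mono) auto
    then show ?case by simp
  qed
  then show "\<exists>c. AE t in leb_I. \<bar>f t\<bar> \<le> c" ..
next
  fix c assume f: "f \<in> borel_measurable leb_I" "AE t in leb_I. \<bar>f t\<bar> \<le> c"
  have "Linf_norm f \<le> ennreal c"
    unfolding Linf_norm_def using f by (intro esssup_I) (auto elim!: eventually_mono intro: ennreal_leI)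
  also have "\<dots> < \<infinity>" by simp
  finally show "f \<in> Linf" using f by (simp add: Linf_def)
qed

lemma Linf_operator_bound:
  assumes c: "0 \<le> c" "op_norm Linf Linf_norm T \<le> ennreal c"
    and f: "f \<in> borel_measurable leb_I" "AE t in leb_I. \<bar>f t\<bar> \<le> 1"
  shows "AE t in leb_I. \<bar>T f t\<bar> \<le> c"
proof -
  have "Linf_norm f \<le> 1"
    unfolding Linf_norm_def using f by (intro esssup_I) (auto elim!: eventually_mono)
  moreover have "f \<in> Linf" using f by (auto simp: Linf_iff)
  ultimately have "Linf_norm (T f) \<le> op_norm Linf Linf_norm T"
    unfolding op_norm_def by (intro SUP_upper) auto
  then have le: "Linf_norm (T f) \<le> ennreal c" using c(2) by (rule order_trans)
  show ?thesis
    using esssup_AE[where M = leb_I and f = "\<lambda>t. ennreal \<bar>T f t\<bar>"]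
  proof eventually_elim
    case (elim t)
    then have "ennreal \<bar>T f t\<bar> \<le> ennreal c"
      using le by (simp add: Linf_norm_def)
    then show ?case using c by simp
  qed
qed

lemma Linf_integrable: "f \<in> Linf \<Longrightarrow> integrable leb_I f"
proof -
  assume "f \<in> Linf"
  then obtain c where "f \<in> borel_measurable leb_I" "AE t in leb_I. \<bar>f t\<bar> \<le> c" by (auto simp: Linf_iff)
  then show ?thesis by (intro leb.integrable_const_bound[where B = c]) auto
qed

text \<open>
  An instance of the closed graph theorem, proved by nested balls of \<^const>\<open>Linf\<close>. If \<open>T\<close> is unbounded,
  then each ball contains a function \<open>s'\<close> with \<open>\<bar>T s'\<bar> > k + 1\<close> on a set of positive measure. Continuity
  in \<^const>\<open>L1\<close> shows that \<open>\<bar>T g\<bar> \<le> k\<close> fails for all \<open>g\<close> in a small ball around \<open>s'\<close>. A function in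
  the intersection of the balls would have an unbounded image.
\<close>

lemma automatic_Linf_bound:
  assumes T: "linear_L1 T" and c: "0 \<le> c"
    and T1: "\<And>f. integrable leb_I f \<Longrightarrow> (\<integral>t. \<bar>T f t\<bar> \<partial>leb_I) \<le> c * (\<integral>t. \<bar>f t\<bar> \<partial>leb_I)"
    and TLinf: "T ` Linf \<subseteq> Linf"
  shows "\<exists>M>0. \<forall>f\<in>borel_measurable leb_I. (AE t in leb_I. \<bar>f t\<bar> \<le> 1) \<longrightarrow> (AE t in leb_I. \<bar>T f t\<bar> \<le> M)"
proof (rule ccontr)
  assume contr: "\<not> ?thesis"
  have large: "\<exists>f. f \<in> borel_measurable leb_I \<and> (\<forall>t. \<bar>f t\<bar> \<le> 1) \<and> \<not> (AE t in leb_I. \<bar>T f t\<bar> \<le> M)"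
    if M: "0 < M" for M
  proof -
    obtain f where f [measurable]: "f \<in> borel_measurable leb_I" and f1: "AE t in leb_I. \<bar>f t\<bar> \<le> 1"
      and Tf: "\<not> (AE t in leb_I. \<bar>T f t\<bar> \<le> M)"
      using contr M by blast
    define g where "g = (\<lambda>t. max (-1) (min 1 (f t)))"
    have g [measurable]: "g \<in> borel_measurable leb_I" unfolding g_def by measurable
    have g1: "\<bar>g t\<bar> \<le> 1" for t by (auto simp: g_def)
    have "f \<in> Linf" "g \<in> Linf" using f g f1 g1 by (auto simp: Linf_iff)
    moreover have "AE t in leb_I. f t = g t"
      using f1 by eventually_elim (auto simp: g_def)
    ultimately have Tfg: "AE t in leb_I. T f t = T g t"
      by (intro linear_L1_cong[OF T] Linf_integrable)
    have "\<not> (AE t in leb_I. \<bar>T g t\<bar> \<le> M)"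
    proof
      assume "AE t in leb_I. \<bar>T g t\<bar> \<le> M"
      with Tfg have "AE t in leb_I. \<bar>T f t\<bar> \<le> M" by eventually_elim simp
      with Tf show False ..
    qed
    then show ?thesis using g g1 by blast
  qed
  have step: "\<exists>s' \<rho>'. s' \<in> Linf \<and> 0 < \<rho>' \<and> \<rho>' \<le> \<rho> / 2 \<and> (\<forall>t. \<bar>s' t - s t\<bar> \<le> \<rho> / 2) \<and>
      (\<forall>g\<in>borel_measurable leb_I. (\<forall>t. \<bar>g t - s' t\<bar> \<le> \<rho>') \<longrightarrow> \<not> (AE t in leb_I. \<bar>T g t\<bar> \<le> k))"
    if s: "s \<in> Linf" and \<rho>: "0 < \<rho>" and k: "0 \<le> k" for s and \<rho> k :: real
  proof -
    have "T s \<in> Linf" using TLinf s by auto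
    then obtain b' where b': "AE t in leb_I. \<bar>T s t\<bar> \<le> b'" by (auto simp: Linf_iff)
    define b where "b = max b' 0"
    have b: "AE t in leb_I. \<bar>T s t\<bar> \<le> b" "0 \<le> b"
      using b' by (auto simp: b_def elim: eventually_mono)
    \<comment> \<open>Large enough for a perturbation of size \<open>\<rho> / 2\<close> to push \<open>T s\<close> beyond \<open>k + 1\<close>.\<close>
    define M where "M = (2 / \<rho>) * (k + 1 + b)"
    have "0 < M" using \<rho> k b by (simp add: M_def)
    from large[OF this] obtain f where f: "f \<in> borel_measurable leb_I" and f1: "\<And>t. \<bar>f t\<bar> \<le> 1"
      and Tf: "\<not> (AE t in leb_I. \<bar>T f t\<bar> \<le> M)" by blast
    have fL: "f \<in> Linf" using f f1 by (auto simp: Linf_iff)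
    define s' where "s' = (\<lambda>t. s t + (\<rho> / 2) * f t)"
    have s_int: "integrable leb_I s" "integrable leb_I f"
      using s fL by (auto intro: Linf_integrable)
    then have s'_int: "integrable leb_I s'" by (simp add: s'_def)
    have s'_near: "\<bar>s' t - s t\<bar> \<le> \<rho> / 2" for t
      using f1[of t] \<rho> by (simp add: s'_def abs_mult mult_left_le)
    have s'L: "s' \<in> Linf"
    proof -
      obtain c' where "AE t in leb_I. \<bar>s t\<bar> \<le> c'" using s by (auto simp: Linf_iff)
      then have "AE t in leb_I. \<bar>s' t\<bar> \<le> c' + \<rho> / 2"
      proof eventually_elim
        case (elim t)
        then show ?case using s'_near[of t] by linarith
      qed
      then show ?thesis using s'_int by (auto simp: Linf_iff)
    qed
    have "integrable leb_I (\<lambda>t. (\<rho> / 2) * f t)" using s_int by simp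
    from linear_L1_add[OF T s_int(1) this] linear_L1_scale[OF T s_int(2), of "\<rho> / 2"]
    have Ts': "AE t in leb_I. T s' t = T s t + (\<rho> / 2) * T f t"
      unfolding s'_def by eventually_elim (simp only:)
    have Ts'_int: "integrable leb_I (T s')" by (rule linear_L1_integrable[OF T s'_int])
    then have [measurable]: "T s' \<in> borel_measurable leb_I" by auto
    define E where "E = {t\<in>space leb_I. k + 1 < \<bar>T s' t\<bar>}"
    have E [measurable]: "E \<in> sets leb_I" unfolding E_def by measurable
    have e: "0 < measure leb_I E"
    proof (rule ccontr)
      assume "\<not> 0 < measure leb_I E"
      then have "measure leb_I E = 0" using measure_nonneg[of leb_I E] by linarith
      then have "E \<in> null_sets leb_I" using E by (auto simp: null_sets_def leb.emeasure_eq_measure)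
      from AE_not_in[OF this] AE_space have "AE t in leb_I. \<bar>T s' t\<bar> \<le> k + 1"
        by eventually_elim (auto simp: E_def)
      with b(1) Ts' have "AE t in leb_I. \<bar>T f t\<bar> \<le> M"
      proof eventually_elim
        case (elim t)
        have "(\<rho> / 2) * \<bar>T f t\<bar> = \<bar>(\<rho> / 2) * T f t\<bar>" using \<rho> by (simp add: abs_mult)
        also have "\<dots> \<le> k + 1 + b" using elim by linarith
        finally show ?case using \<rho> by (simp add: M_def field_simps)
      qed
      with Tf show False ..
    qed
    \<comment> \<open>So small that \<open>T\<close> moves a function at distance \<open>\<rho>'\<close> by less than the measure of \<open>E\<close> in
      the norm of \<^const>\<open>L1\<close>.\<close>
    define \<rho>' where "\<rho>' = min (\<rho> / 2) (measure leb_I E / (2 * (c + 1)))"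
    have "0 < measure leb_I E / (2 * (c + 1))" using e c by simp
    then have \<rho>': "0 < \<rho>'" using \<rho> by (simp add: \<rho>'_def)
    have \<rho>'2: "\<rho>' \<le> \<rho> / 2" unfolding \<rho>'_def by (rule min.cobounded1)
    have "c * \<rho>' \<le> c * (measure leb_I E / (2 * (c + 1)))"
      using c unfolding \<rho>'_def by (intro mult_left_mono min.cobounded2)
    also have "\<dots> \<le> measure leb_I E / 2"
      using c e by (simp add: field_simps)
    also have "\<dots> < measure leb_I E" using e by simp
    finally have small: "c * \<rho>' < measure leb_I E" .
    have "\<not> (AE t in leb_I. \<bar>T g t\<bar> \<le> k)"
      if g: "g \<in> borel_measurable leb_I" and near: "\<And>t. \<bar>g t - s' t\<bar> \<le> \<rho>'" for g
    proof
      assume Tg: "AE t in leb_I. \<bar>T g t\<bar> \<le> k"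
      have diff_int: "integrable leb_I (\<lambda>t. g t - s' t)"
        using g s'_int near by (intro leb.integrable_const_bound[where B = \<rho>']) auto
      have "integrable leb_I (\<lambda>t. s' t + (g t - s' t))" using s'_int diff_int by (rule Bochner_Integration.integrable_add)
      then have g_int: "integrable leb_I g" by simp
      have "measure leb_I E = (\<integral>t. indicat_real E t \<partial>leb_I)"
        using sets.sets_into_space[OF E] by (simp add: Int_absorb2)
      also have "\<dots> \<le> (\<integral>t. \<bar>T (\<lambda>t. g t - s' t) t\<bar> \<partial>leb_I)"
      proof (rule integral_mono_AE)
        show "integrable leb_I (indicat_real E)"
          by (intro integrable_real_indicator E) (simp add: leb.emeasure_eq_measure)
        show "integrable leb_I (\<lambda>t. \<bar>T (\<lambda>t. g t - s' t) t\<bar>)"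
          using linear_L1_integrable[OF T diff_int] by auto
        show "AE t in leb_I. indicat_real E t \<le> \<bar>T (\<lambda>t. g t - s' t) t\<bar>"
          using Tg linear_L1_diff[OF T g_int s'_int]
          by eventually_elim (auto simp: indicator_def E_def)
      qed
      also have "\<dots> \<le> c * (\<integral>t. \<bar>g t - s' t\<bar> \<partial>leb_I)" by (rule T1[OF diff_int])
      also have "\<dots> \<le> c * \<rho>'"
      proof (rule mult_left_mono[OF _ c])
        have "(\<integral>t. \<bar>g t - s' t\<bar> \<partial>leb_I) \<le> (\<integral>t. \<rho>' \<partial>leb_I)"
          using diff_int near by (intro integral_mono) auto
        then show "(\<integral>t. \<bar>g t - s' t\<bar> \<partial>leb_I) \<le> \<rho>'" by (simp add: leb.prob_space)
      qed
      finally show False using small by simp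
    qed
    with s'L \<rho>' \<rho>'2 s'_near show ?thesis by blast
  qed
  define P where "P = (\<lambda>x::fn \<times> real. fst x \<in> Linf \<and> 0 < snd x)"
  define Q where "Q = (\<lambda>(n::nat) (x::fn \<times> real) (y::fn \<times> real). snd y \<le> snd x / 2 \<and>
      (\<forall>t. \<bar>fst y t - fst x t\<bar> \<le> snd x / 2) \<and>
      (\<forall>g\<in>borel_measurable leb_I. (\<forall>t. \<bar>g t - fst y t\<bar> \<le> snd y) \<longrightarrow> \<not> (AE t in leb_I. \<bar>T g t\<bar> \<le> real n)))"
  have "\<exists>f. \<forall>n. P (f n) \<and> Q n (f n) (f (Suc n))"
  proof (rule dependent_nat_choice)
    have "(\<lambda>_. 0) \<in> Linf" by (auto simp: Linf_iff)
    then show "\<exists>x. P x" by (intro exI[of _ "(\<lambda>_. 0, 1)"]) (simp add: P_def)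
    fix x n assume "P x"
    then obtain s' \<rho>' where "s' \<in> Linf" "0 < \<rho>'" "\<rho>' \<le> snd x / 2" "\<forall>t. \<bar>s' t - fst x t\<bar> \<le> snd x / 2"
      "\<forall>g\<in>borel_measurable leb_I. (\<forall>t. \<bar>g t - s' t\<bar> \<le> \<rho>') \<longrightarrow> \<not> (AE t in leb_I. \<bar>T g t\<bar> \<le> real n)"
      using step[of "fst x" "snd x" "real n"] unfolding P_def by auto
    then show "\<exists>y. P y \<and> Q n x y" by (intro exI[of _ "(s', \<rho>')"]) (simp add: P_def Q_def)
  qed
  then obtain f where fP: "\<And>n. P (f n)" and fQ: "\<And>n. Q n (f n) (f (Suc n))" by blast
  define s where "s n = fst (f n)" for n
  define \<rho> where "\<rho> n = snd (f n)" for n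
  have \<rho>0: "0 < \<rho> n" for n using fP[of n] by (simp add: P_def \<rho>_def)
  have sL: "s n \<in> Linf" for n using fP[of n] by (simp add: P_def s_def)
  then have [measurable]: "s n \<in> borel_measurable leb_I" for n by (simp add: Linf_iff)
  have near: "\<bar>s (Suc n) t - s n t\<bar> \<le> \<rho> n / 2" "\<rho> (Suc n) \<le> \<rho> n / 2" for n t
    using fQ[of n] by (auto simp: Q_def s_def \<rho>_def)
  \<comment> \<open>The intervals \<open>[s n t - \<rho> n, s n t + \<rho> n]\<close> are nested for every \<open>t\<close>.\<close>
  have inc: "s m t - \<rho> m \<le> s n t - \<rho> n" if "m \<le> n" for m n t
    using that
  proof (rule lift_Suc_mono_le[rotated])
    show "s n t - \<rho> n \<le> s (Suc n) t - \<rho> (Suc n)" for n using near(1)[of n t] near(2)[of n] by linarith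
  qed
  have dec: "s n t + \<rho> n \<le> s m t + \<rho> m" if "m \<le> n" for m n t
    using that
  proof (rule lift_Suc_antimono_le[rotated])
    show "s (Suc n) t + \<rho> (Suc n) \<le> s n t + \<rho> n" for n using near(1)[of n t] near(2)[of n] by linarith
  qed
  have cross: "s m t - \<rho> m \<le> s n t + \<rho> n" for m n t
    using inc[of m "max m n" t] dec[of n "max m n" t] \<rho>0[of "max m n"] by linarith
  have bdd: "bdd_above (range (\<lambda>n. s n t - \<rho> n))" for t
    using cross[of _ t 0] by (intro bdd_aboveI2) auto
  define g where "g = (\<lambda>t. SUP n. s n t - \<rho> n)"
  have g [measurable]: "g \<in> borel_measurable leb_I"
    unfolding g_def using bdd by (intro borel_measurable_cSUP) auto
  have g_near: "\<bar>g t - s n t\<bar> \<le> \<rho> n" for n t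
  proof -
    have "s n t - \<rho> n \<le> g t" unfolding g_def by (rule cSUP_upper[OF _ bdd]) simp
    moreover have "g t \<le> s n t + \<rho> n" unfolding g_def by (rule cSUP_least) (use cross in auto)
    ultimately show ?thesis by linarith
  qed
  have "g \<in> Linf"
  proof -
    obtain c' where "AE t in leb_I. \<bar>s 0 t\<bar> \<le> c'" using sL[of 0] by (auto simp: Linf_iff)
    then have "AE t in leb_I. \<bar>g t\<bar> \<le> c' + \<rho> 0"
    proof eventually_elim
      case (elim t)
      then show ?case using g_near[of t 0] by linarith
    qed
    then show ?thesis by (auto simp: Linf_iff)
  qed
  then have "T g \<in> Linf" using TLinf by auto
  then obtain c' where c': "AE t in leb_I. \<bar>T g t\<bar> \<le> c'" by (auto simp: Linf_iff)
  obtain n :: nat where "c' \<le> real n" using real_arch_simple by blast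
  then have "AE t in leb_I. \<bar>T g t\<bar> \<le> real n" using c' by (auto elim: eventually_mono)
  moreover have "\<not> (AE t in leb_I. \<bar>T g t\<bar> \<le> real n)"
    using fQ[of n] g g_near[of _ "Suc n"] by (auto simp: Q_def s_def \<rho>_def)
  ultimately show False by blast
qed

text \<open>
  Positivity gives \<open>\<bar>T f\<bar> \<le> T \<bar>f\<bar>\<close>, and \<open>T\<close> preserves integrals because its adjoint fixes the constant
  function 1; so \<open>T\<close> is a contraction of \<^const>\<open>L1\<close>.
\<close>

lemma double_stochastic_L1_Linf:
  assumes T: "double_stochastic T"
  shows "L1_Linf_operator T"
proof -
  have lin: "linear_L1 T" and TLinf: "T ` Linf \<subseteq> Linf"
    and pos: "\<And>f. \<lbrakk>integrable leb_I f; AE t in leb_I. 0 \<le> f t\<rbrakk> \<Longrightarrow> AE t in leb_I. 0 \<le> T f t"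
    and int: "\<And>f. integrable leb_I f \<Longrightarrow> (\<integral>t. T f t \<partial>leb_I) = (\<integral>t. f t \<partial>leb_I)"
    using T by (auto simp: double_stochastic_def adjoint_value_def L1_def)
  have contr: "(\<integral>t. \<bar>T f t\<bar> \<partial>leb_I) \<le> (\<integral>t. \<bar>f t\<bar> \<partial>leb_I)" if f: "integrable leb_I f" for f
  proof -
    have abs: "integrable leb_I (\<lambda>t. \<bar>f t\<bar>)" using f by simp
    have "AE t in leb_I. \<bar>T f t\<bar> \<le> T (\<lambda>t. \<bar>f t\<bar>) t"
    proof -
      have "AE t in leb_I. 0 \<le> T (\<lambda>t. \<bar>f t\<bar> - f t) t" "AE t in leb_I. 0 \<le> T (\<lambda>t. \<bar>f t\<bar> + f t) t"
        using f abs by (auto intro!: pos)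
      with linear_L1_diff[OF lin abs f] linear_L1_add[OF lin abs f] show ?thesis
        by eventually_elim (simp add: abs_le_iff)
    qed
    then have "(\<integral>t. \<bar>T f t\<bar> \<partial>leb_I) \<le> (\<integral>t. T (\<lambda>t. \<bar>f t\<bar>) t \<partial>leb_I)"
      using linear_L1_integrable[OF lin f] linear_L1_integrable[OF lin abs]
      by (intro integral_mono_AE) auto
    then show ?thesis using int[OF abs] by simp
  qed
  have "op_norm L1 L1_norm T \<le> 1"
    unfolding op_norm_def
  proof (rule SUP_least)
    fix f assume "f \<in> {f \<in> L1. L1_norm f \<le> 1}"
    then have f: "integrable leb_I f" "L1_norm f \<le> 1" by (auto simp: L1_def)
    have "L1_norm (T f) \<le> L1_norm f"
      using contr[OF f(1)] L1_norm_integrable[OF f(1)] L1_norm_integrable[OF linear_L1_integrable[OF lin f(1)]]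
      by (simp add: ennreal_leI)
    then show "L1_norm (T f) \<le> 1" using f(2) by (rule order_trans)
  qed
  then have "op_norm L1 L1_norm T < \<infinity>" by (rule order_le_less_trans) simp
  then show ?thesis
    using lin TLinf by (simp add: L1_Linf_operator_def bounded_linear_L1_def)
qed

lemma orbit_subset:
  assumes "majorant_ideal X" "x \<in> X"
  shows "orbit x \<subseteq> X"
  using assms double_stochastic_L1_Linf by (auto simp: orbit_def majorant_ideal_def)

section \<open>Images under operators\<close>

text \<open>
  Rounding up to powers of \<open>r\<close> replaces a function by one with countably many values, at the price of
  a factor \<open>r\<close>. The label 0 is reserved for the zero set, where no positive value is admissible.
\<close>

lemma geometric_levels:
  fixes r :: real
  assumes [measurable]: "y \<in> borel_measurable leb_I" and r: "1 < r"
  obtains lev :: "real \<Rightarrow> nat" and a :: "nat \<Rightarrow> real"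
  where "lev \<in> leb_I \<rightarrow>\<^sub>M count_space UNIV" "a 0 = 0" "\<And>n. 0 \<le> a n"
    "\<And>t. \<bar>y t\<bar> \<le> a (lev t)" "\<And>t. a (lev t) \<le> r * \<bar>y t\<bar>"
proof
  define lev where "lev = (\<lambda>t. if y t = 0 then 0 else Suc (to_nat \<lfloor>log r \<bar>y t\<bar>\<rfloor>))"
  define a where "a = (\<lambda>n. case n of 0 \<Rightarrow> 0 | Suc m \<Rightarrow> r powr (of_int (from_nat m) + 1))"
  show "lev \<in> leb_I \<rightarrow>\<^sub>M count_space UNIV"
    unfolding lev_def by measurable
  show "a 0 = 0" "\<And>n. 0 \<le> a n" by (auto simp: a_def split: nat.split)
  fix t
  show "\<bar>y t\<bar> \<le> a (lev t)"
  proof (cases "y t = 0")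
    case False
    then have "\<bar>y t\<bar> = r powr log r \<bar>y t\<bar>" using r by simp
    also have "\<dots> \<le> r powr (of_int \<lfloor>log r \<bar>y t\<bar>\<rfloor> + 1)"
      using r by (intro powr_mono) linarith+
    finally show ?thesis using False by (simp add: a_def lev_def)
  qed (simp add: a_def lev_def)
  show "a (lev t) \<le> r * \<bar>y t\<bar>"
  proof (cases "y t = 0")
    case False
    have "r powr (of_int \<lfloor>log r \<bar>y t\<bar>\<rfloor> + 1) \<le> r powr (log r \<bar>y t\<bar> + 1)"
      using r by (intro powr_mono) linarith+
    also have "\<dots> = r * \<bar>y t\<bar>" using False r by (simp add: powr_add)
    finally show ?thesis using False by (simp add: a_def lev_def)
  qed (simp add: a_def lev_def)
qed

context averaging_stable begin

text \<open>
  Let \<open>y = T x\<close>, let \<open>A n\<close> and \<open>B m\<close> be level sets of \<open>x\<close> and \<open>y\<close>, and write \<open>x\<close> on \<open>A n\<close> as \<open>a n\<close> times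
  a function \<open>u n\<close> bounded by 1. Pairing \<open>T (u n)\<close> with the sign of \<open>y\<close> on \<open>B m\<close> gives a matrix whose
  entries, in absolute value and divided by \<open>M\<close>, sum over \<open>n\<close> to at most the measure of \<open>B m\<close>, by the
  bound for \<open>T\<close> on \<^const>\<open>Linf\<close>, and over \<open>m\<close> to at most the measure of \<open>A n\<close>, by the bound on
  \<^const>\<open>L1\<close>. So the values \<open>a n\<close> can be moved in these amounts into the sets \<open>B m\<close> by \<open>transport\<close>, and
  averaging the result over \<open>B m\<close> recovers \<open>\<bar>y\<bar> / M\<close> there, up to rounding.
\<close>

lemma operator_image:
  assumes T: "linear_L1 T"
    and M: "0 < M"
    and T1: "\<And>f. integrable leb_I f \<Longrightarrow> (\<integral>t. \<bar>T f t\<bar> \<partial>leb_I) \<le> M * (\<integral>t. \<bar>f t\<bar> \<partial>leb_I)"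
    and Tinf: "\<And>f. \<lbrakk>f \<in> borel_measurable leb_I; AE t in leb_I. \<bar>f t\<bar> \<le> 1\<rbrakk> \<Longrightarrow> AE t in leb_I. \<bar>T f t\<bar> \<le> M"
    and x: "x \<in> C"
  shows "(\<lambda>t. T x t / M) \<in> C"
proof -
  note Tint = linear_L1_integrable[OF T] and Tadd = linear_L1_add[OF T] and Tscale = linear_L1_scale[OF T]
  have Tsum: "AE t in leb_I. T (\<lambda>s. \<Sum>n<K. c n * u n s) t = (\<Sum>n<K. c n * T (u n) t)"
    if u: "\<And>n. integrable leb_I (u n)" for u :: "nat \<Rightarrow> fn" and c :: "nat \<Rightarrow> real" and K :: nat
  proof (induction K)
    case 0
    have "AE t in leb_I. T (\<lambda>s. 0 * (0::real)) t = 0 * T (\<lambda>s. 0) t"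
      by (rule Tscale) simp
    then show ?case by simp
  next
    case (Suc K)
    have "integrable leb_I (\<lambda>s. \<Sum>n<K. c n * u n s)" "integrable leb_I (\<lambda>s. c K * u K s)"
      using u by auto
    from Tadd[OF this] Tscale[OF u, of "c K" K] Suc.IH show ?case
      by eventually_elim simp
  qed
  have xint: "integrable leb_I x" by (rule integrable[OF x])
  then have xmeas [measurable]: "x \<in> borel_measurable leb_I" by auto
  define y where "y = T x"
  have yint: "integrable leb_I y" unfolding y_def by (rule Tint[OF xint])
  then have ymeas [measurable]: "y \<in> borel_measurable leb_I" by auto
  have main: "(\<lambda>t. y t / (r^2 * M)) \<in> C" if r: "1 < r" for r
  proof -
    obtain lx :: "real \<Rightarrow> nat" and a :: "nat \<Rightarrow> real" where lx [measurable]: "lx \<in> leb_I \<rightarrow>\<^sub>M count_space UNIV"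
      and a: "a 0 = 0" "\<And>n. 0 \<le> a n" "\<And>t. \<bar>x t\<bar> \<le> a (lx t)" "\<And>t. a (lx t) \<le> r * \<bar>x t\<bar>"
      by (rule geometric_levels[OF xmeas r]) (rule that)
    obtain ly :: "real \<Rightarrow> nat" and b :: "nat \<Rightarrow> real" where ly [measurable]: "ly \<in> leb_I \<rightarrow>\<^sub>M count_space UNIV"
      and b: "b 0 = 0" "\<And>n. 0 \<le> b n" "\<And>t. \<bar>y t\<bar> \<le> b (ly t)" "\<And>t. b (ly t) \<le> r * \<bar>y t\<bar>"
      by (rule geometric_levels[OF ymeas r]) (rule that)
    define A where "A n = {t\<in>space leb_I. lx t = n}" for n
    define B where "B m = {t\<in>space leb_I. ly t = m}" for m
    have A [measurable]: "A n \<in> sets leb_I" for n unfolding A_def by measurable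
    have B [measurable]: "B m \<in> sets leb_I" for m unfolding B_def by measurable
    \<comment> \<open>As \<open>a 0 = 0\<close>, division by zero makes \<open>u 0\<close> vanish, in accordance with \<open>x = 0\<close> on \<open>A 0\<close>.\<close>
    define u where "u n t = indicat_real (A n) t * x t / a n" for n t
    define h where "h m t = indicat_real (B m) t * sgn (y t)" for m t
    have u_int: "integrable leb_I (u n)" for n
      unfolding u_def using integrable_mult_indicator[OF A xint] by simp
    have u_meas [measurable]: "u n \<in> borel_measurable leb_I" for n
      using u_int by auto
    have u_le: "\<bar>u n t\<bar> \<le> indicat_real (A n) t" for n t
      using a(2)[of n] a(3)[of t] by (auto simp: u_def A_def indicator_def divide_le_eq)
    have au: "a n * u n t = indicat_real (A n) t * x t" for n t
      using a(3)[of t] by (auto simp: u_def A_def indicator_def)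
    have h_meas [measurable]: "h m \<in> borel_measurable leb_I" for m unfolding h_def by measurable
    have h_le: "\<bar>h m t\<bar> \<le> indicat_real (B m) t" for m t
      by (auto simp: h_def indicator_def sgn_if)
    have h_le1: "\<bar>h m t\<bar> \<le> 1" for m t
      by (auto simp: h_def indicator_def sgn_if)
    have hf_int: "integrable leb_I (\<lambda>t. h m t * f t)" if "integrable leb_I f" for m f
      by (rule Bochner_Integration.integrable_bound[OF that])
         (use that h_le1 in \<open>auto simp: abs_mult mult_left_le_one_le\<close>)
    define \<tau> where "\<tau> m n = (\<integral>t. h m t * T (u n) t \<partial>leb_I)" for m n
    define v where "v m n = \<bar>\<tau> m n\<bar> / M" for m n
    have v0: "0 \<le> v m n" for m n using M by (simp add: v_def)
    have v_m0: "v m 0 = 0" for m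
    proof -
      have "u 0 = (\<lambda>s. 0 * (0::real))" using a(1) by (auto simp: u_def)
      then have "AE t in leb_I. T (u 0) t = 0 * T (\<lambda>_. 0) t" using Tscale[of "\<lambda>_. 0" 0] by simp
      then have "\<tau> m 0 = (\<integral>t. 0 \<partial>leb_I)"
        unfolding \<tau>_def using Tint[OF u_int[of 0]] by (intro integral_cong_AE) auto
      then show ?thesis by (simp add: v_def)
    qed
    have rows: "(\<Sum>n<K. v m n) \<le> measure leb_I (B m)" for m K
    proof -
      \<comment> \<open>The signs turn the sum of absolute values into one integral of the image of a function
        bounded by 1, since the \<open>u n\<close> have disjoint supports.\<close>
      define \<epsilon> where "\<epsilon> n = sgn (\<tau> m n)" for n
      define f where "f = (\<lambda>s. \<Sum>n<K. \<epsilon> n * u n s)"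
      have f_int: "integrable leb_I f" unfolding f_def using u_int by auto
      have "\<bar>f t\<bar> \<le> 1" if "t \<in> space leb_I" for t
      proof -
        have "\<bar>f t\<bar> \<le> (\<Sum>n<K. \<bar>\<epsilon> n * u n t\<bar>)" unfolding f_def by (rule sum_abs)
        also have "\<dots> \<le> (\<Sum>n<K. if n = lx t then 1 else 0)"
        proof (rule sum_mono)
          fix n
          have "\<bar>\<epsilon> n * u n t\<bar> \<le> \<bar>u n t\<bar>"
            by (auto simp: \<epsilon>_def abs_mult sgn_if)
          also have "\<dots> \<le> (if n = lx t then 1 else 0)"
            using u_le[of n t] that by (auto simp: A_def indicator_def split: if_splits)
          finally show "\<bar>\<epsilon> n * u n t\<bar> \<le> (if n = lx t then 1 else 0)" .
        qed
        also have "\<dots> \<le> 1" by simp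
        finally show ?thesis .
      qed
      then have Tf: "AE t in leb_I. \<bar>T f t\<bar> \<le> M"
        using f_int by (intro Tinf) auto
      have "(\<Sum>n<K. \<bar>\<tau> m n\<bar>) = (\<Sum>n<K. \<epsilon> n * \<tau> m n)"
        by (simp add: \<epsilon>_def abs_sgn mult.commute)
      also have "\<dots> = (\<integral>t. (\<Sum>n<K. \<epsilon> n * (h m t * T (u n) t)) \<partial>leb_I)"
        unfolding \<tau>_def using hf_int[OF Tint[OF u_int]] by (subst Bochner_Integration.integral_sum) auto
      also have "\<dots> = (\<integral>t. h m t * T f t \<partial>leb_I)"
      proof (rule integral_cong_AE)
        show "AE t in leb_I. (\<Sum>n<K. \<epsilon> n * (h m t * T (u n) t)) = h m t * T f t"
          using Tsum[where u=u and c=\<epsilon> and K=K, OF u_int] unfolding f_def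
          by eventually_elim (simp add: sum_distrib_left mult_ac)
      qed (use Tint[OF u_int] Tint[OF f_int] in auto)
      also have "\<dots> \<le> (\<integral>t. indicat_real (B m) t * M \<partial>leb_I)"
      proof (rule integral_mono_AE)
        show "integrable leb_I (\<lambda>t. h m t * T f t)" by (rule hf_int[OF Tint[OF f_int]])
        show "integrable leb_I (\<lambda>t. indicat_real (B m) t * M)"
          by (intro integrable_mult_left integrable_real_indicator B) (simp add: leb.emeasure_eq_measure)
        show "AE t in leb_I. h m t * T f t \<le> indicat_real (B m) t * M"
          using Tf
        proof eventually_elim
          case (elim t)
          have "h m t * T f t \<le> \<bar>h m t\<bar> * \<bar>T f t\<bar>" by (metis abs_ge_self abs_mult)
          also have "\<dots> \<le> indicat_real (B m) t * M" using elim h_le by (intro mult_mono) auto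
          finally show ?case .
        qed
      qed
      also have "\<dots> = measure leb_I (B m) * M"
        using sets.sets_into_space[OF B] by (simp add: Int_absorb2)
      finally show ?thesis using M by (simp add: v_def sum_divide_distrib[symmetric] divide_le_eq)
    qed
    have columns: "(\<Sum>m<K. v m n) \<le> measure leb_I (A n)" for n K
    proof -
      have "(\<Sum>m<K. \<bar>\<tau> m n\<bar>) \<le> (\<Sum>m<K. \<integral>t. \<bar>h m t * T (u n) t\<bar> \<partial>leb_I)"
        unfolding \<tau>_def by (intro sum_mono integral_abs_bound)
      also have "\<dots> = (\<integral>t. (\<Sum>m<K. \<bar>h m t * T (u n) t\<bar>) \<partial>leb_I)"
        using hf_int[OF Tint[OF u_int]] by (subst Bochner_Integration.integral_sum) auto
      also have "\<dots> \<le> (\<integral>t. \<bar>T (u n) t\<bar> \<partial>leb_I)"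
      proof (rule integral_mono)
        show "integrable leb_I (\<lambda>t. \<Sum>m<K. \<bar>h m t * T (u n) t\<bar>)"
          using hf_int[OF Tint[OF u_int]] by auto
        show "integrable leb_I (\<lambda>t. \<bar>T (u n) t\<bar>)" using Tint[OF u_int] by auto
        fix t
        have "(\<Sum>m<K. \<bar>h m t * T (u n) t\<bar>) \<le> (\<Sum>m<K. if m = ly t then \<bar>T (u n) t\<bar> else 0)"
        proof (rule sum_mono)
          fix m
          show "\<bar>h m t * T (u n) t\<bar> \<le> (if m = ly t then \<bar>T (u n) t\<bar> else 0)"
            using h_le[of m t] h_le1[of m t]
            by (auto simp: B_def indicator_def abs_mult mult_left_le_one_le split: if_splits)
        qed
        also have "\<dots> \<le> \<bar>T (u n) t\<bar>" by simp
        finally show "(\<Sum>m<K. \<bar>h m t * T (u n) t\<bar>) \<le> \<bar>T (u n) t\<bar>" .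
      qed
      also have "\<dots> \<le> M * (\<integral>t. \<bar>u n t\<bar> \<partial>leb_I)" by (rule T1[OF u_int])
      also have "(\<integral>t. \<bar>u n t\<bar> \<partial>leb_I) \<le> (\<integral>t. indicat_real (A n) t \<partial>leb_I)"
        using u_int u_le by (intro integral_mono integrable_real_indicator) (auto simp: leb.emeasure_eq_measure)
      also have "\<dots> = measure leb_I (A n)"
        using sets.sets_into_space[OF A] by (simp add: Int_absorb2)
      finally show ?thesis using M
        by (simp add: v_def sum_divide_distrib[symmetric] divide_le_eq mult.commute)
    qed
    have v_summable: "summable (v m)" for m
      by (rule bounded_imp_summable[OF v0 rows[of _ "Suc _", unfolded lessThan_Suc_atMost]])
    \<comment> \<open>The part of \<open>B m\<close> that receives nothing gets the label 0, where \<open>a\<close> vanishes.\<close>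
    define w where "w m n = v m n + (if n = 0 then measure leb_I (B m) - suminf (v m) else 0)" for m n
    have w0: "0 \<le> w m n" for m n
    proof -
      have "suminf (v m) \<le> measure leb_I (B m)" by (rule suminf_le_const[OF v_summable rows])
      then show ?thesis using v0[of m n] by (simp add: w_def)
    qed
    have w: "w m sums measure leb_I {t\<in>space leb_I. ly t = m}" for m
    proof -
      have "(\<lambda>n. if n = 0 then measure leb_I (B m) - suminf (v m) else 0) sums (measure leb_I (B m) - suminf (v m))"
        using sums_single[of 0 "\<lambda>_. measure leb_I (B m) - suminf (v m)"] by simp
      from sums_add[OF summable_sums[OF v_summable[of m]] this] show ?thesis
        by (simp add: w_def[abs_def] B_def)
    qed
    obtain \<sigma> where \<sigma> [measurable]: "\<sigma> \<in> leb_I \<rightarrow>\<^sub>M count_space UNIV"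
      and \<sigma>w: "\<And>m n. measure leb_I {t\<in>space leb_I. ly t = m \<and> \<sigma> t = n} = w m n"
      using refine_label[OF ly w0 w] by blast
    have \<sigma>_le: "measure leb_I {t\<in>space leb_I. \<sigma> t = n} \<le> measure leb_I {t\<in>space leb_I. lx t = n}"
      if "n \<noteq> 0" for n
    proof -
      have S: "{t\<in>space leb_I. \<sigma> t = n} \<in> sets leb_I" by measurable
      have "{t\<in>space leb_I. \<sigma> t = n} \<inter> {t\<in>space leb_I. ly t = m} = {t\<in>space leb_I. ly t = m \<and> \<sigma> t = n}" for m
        by auto
      then have "(\<lambda>m. v m n) sums measure leb_I {t\<in>space leb_I. \<sigma> t = n}"
        using label_total[OF ly S] that by (simp only: \<sigma>w w_def if_False add_0_right)
      then show ?thesis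
        using columns[where n=n] unfolding A_def sums_def by (auto intro: LIMSEQ_le_const2)
    qed
    have quant: "(\<lambda>t. a (lx t) / r) \<in> C"
    proof (rule solid[OF x])
      show "(\<lambda>t. a (lx t) / r) \<in> borel_measurable leb_I"
        using measurable_compose[OF lx, of "\<lambda>n. a n / r" borel] by simp
      show "AE t in leb_I. \<bar>a (lx t) / r\<bar> \<le> \<bar>x t\<bar>"
        using a(2,4) r by (simp add: divide_le_eq mult.commute)
    qed
    have moved: "(\<lambda>t. a (\<sigma> t) / r) \<in> C"
      using transport[OF lx \<sigma>, of "\<lambda>n. a n / r"] quant \<sigma>_le a r by simp
    define I where "I m = (\<integral>t\<in>B m. a (\<sigma> t) / r \<partial>leb_I)" for m
    have I_lower: "(\<Sum>n<K. a n * v m n) \<le> r * I m" for m K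
    proof -
      define D where "D n = {t\<in>space leb_I. ly t = m \<and> \<sigma> t = n}" for n
      have D [measurable]: "D n \<in> sets leb_I" for n unfolding D_def by measurable
      have D_int: "integrable leb_I (\<lambda>t. a n * indicat_real (D n) t)" for n
        by (intro integrable_mult_right integrable_real_indicator D) (simp add: leb.emeasure_eq_measure)
      have "(\<Sum>n<K. a n * v m n) = (\<Sum>n<K. a n * measure leb_I (D n))"
        using a(1) by (intro sum.cong) (auto simp: D_def \<sigma>w w_def)
      also have "\<dots> = (\<integral>t. (\<Sum>n<K. a n * indicat_real (D n) t) \<partial>leb_I)"
        using D_int sets.sets_into_space[OF D]
        by (subst Bochner_Integration.integral_sum) (auto simp: Int_absorb2)
      also have "\<dots> \<le> (\<integral>t. r * (indicat_real (B m) t * (a (\<sigma> t) / r)) \<partial>leb_I)"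
      proof (rule integral_mono)
        show "integrable leb_I (\<lambda>t. \<Sum>n<K. a n * indicat_real (D n) t)"
          using D_int by (rule Bochner_Integration.integrable_sum)
        show "integrable leb_I (\<lambda>t. r * (indicat_real (B m) t * (a (\<sigma> t) / r)))"
          using integrable_mult_indicator[OF B integrable[OF moved], of m]
          by (intro integrable_mult_right) (simp only: real_scaleR_def)
        fix t assume t: "t \<in> space leb_I"
        have "(\<Sum>n<K. a n * indicat_real (D n) t)
            \<le> (\<Sum>n<K. if n = \<sigma> t then indicat_real (B m) t * a (\<sigma> t) else 0)"
          by (rule sum_mono) (auto simp: D_def B_def indicator_def)
        also have "\<dots> \<le> indicat_real (B m) t * a (\<sigma> t)" using a(2) by auto
        finally show "(\<Sum>n<K. a n * indicat_real (D n) t) \<le> r * (indicat_real (B m) t * (a (\<sigma> t) / r))"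
          using r by simp
      qed
      also have "\<dots> = r * I m"
        unfolding I_def set_lebesgue_integral_def by (simp only: integral_mult_right_zero real_scaleR_def)
      finally show ?thesis .
    qed
    have h_y: "(\<integral>t. h m t * y t \<partial>leb_I) \<le> M * (r * I m)" for m
    proof -
      \<comment> \<open>Truncation to finitely many levels; the rest tends to 0 in \<^const>\<open>L1\<close>, hence so does its
        image.\<close>
      define xs where "xs K t = (\<Sum>n<K. a n * u n t)" for K t
      define d where "d K t = x t - xs K t" for K t
      have xs_int: "integrable leb_I (xs K)" for K unfolding xs_def using u_int by auto
      have d_int: "integrable leb_I (d K)" for K unfolding d_def using xs_int xint by auto
      have d_eq: "d K t = (if lx t < K then 0 else x t)" if "t \<in> space leb_I" for K t
      proof -
        have "xs K t = (\<Sum>n<K. if n = lx t then x t else 0)"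
          unfolding xs_def using that by (intro sum.cong) (auto simp: au A_def)
        then show ?thesis by (simp add: d_def)
      qed
      have le: "(\<integral>t. h m t * y t \<partial>leb_I) \<le> M * (r * I m) + M * (\<integral>t. \<bar>d K t\<bar> \<partial>leb_I)" for K
      proof -
        have x_split: "x = (\<lambda>s. xs K s + d K s)" by (simp add: d_def)
        have y_split: "AE t in leb_I. y t = T (xs K) t + T (d K) t"
          unfolding y_def by (subst (1) x_split) (rule Tadd[OF xs_int d_int])
        have "(\<integral>t. h m t * y t \<partial>leb_I) = (\<integral>t. h m t * T (xs K) t + h m t * T (d K) t \<partial>leb_I)"
        proof (rule integral_cong_AE)
          show "AE t in leb_I. h m t * y t = h m t * T (xs K) t + h m t * T (d K) t"
            using y_split by eventually_elim (simp add: distrib_left)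
        qed (use Tint[OF xs_int] Tint[OF d_int] in auto)
        also have "\<dots> = (\<integral>t. h m t * T (xs K) t \<partial>leb_I) + (\<integral>t. h m t * T (d K) t \<partial>leb_I)"
          using hf_int[OF Tint[OF xs_int]] hf_int[OF Tint[OF d_int]] by simp
        also have "(\<integral>t. h m t * T (xs K) t \<partial>leb_I) = (\<integral>t. (\<Sum>n<K. a n * (h m t * T (u n) t)) \<partial>leb_I)"
        proof (rule integral_cong_AE)
          show "AE t in leb_I. h m t * T (xs K) t = (\<Sum>n<K. a n * (h m t * T (u n) t))"
            using Tsum[where u=u and c=a and K=K, OF u_int] unfolding xs_def
            by eventually_elim (simp add: sum_distrib_left mult_ac)
        qed (use Tint[OF u_int] Tint[OF xs_int] in auto)
        also have "\<dots> = (\<Sum>n<K. a n * \<tau> m n)"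
          unfolding \<tau>_def using hf_int[OF Tint[OF u_int]] by (subst Bochner_Integration.integral_sum) auto
        also have "\<dots> \<le> (\<Sum>n<K. M * (a n * v m n))"
          using a(2) M by (intro sum_mono) (auto simp: v_def intro: mult_left_mono)
        also have "\<dots> \<le> M * (r * I m)"
          unfolding sum_distrib_left[symmetric] using M I_lower by (intro mult_left_mono) auto
        also have "(\<integral>t. h m t * T (d K) t \<partial>leb_I) \<le> (\<integral>t. \<bar>T (d K) t\<bar> \<partial>leb_I)"
        proof (rule integral_mono[OF hf_int[OF Tint[OF d_int]]])
          fix t
          have "h m t * T (d K) t \<le> \<bar>h m t\<bar> * \<bar>T (d K) t\<bar>" by (metis abs_ge_self abs_mult)
          also have "\<dots> \<le> 1 * \<bar>T (d K) t\<bar>"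
            using h_le1 by (intro mult_right_mono) auto
          finally show "h m t * T (d K) t \<le> \<bar>T (d K) t\<bar>" by simp
        qed (use Tint[OF d_int] in auto)
        also have "\<dots> \<le> M * (\<integral>t. \<bar>d K t\<bar> \<partial>leb_I)" by (rule T1[OF d_int])
        finally show ?thesis by simp
      qed
      have "(\<lambda>K. \<integral>t. \<bar>d K t\<bar> \<partial>leb_I) \<longlonglongrightarrow> (\<integral>t. 0 \<partial>leb_I)"
      proof (rule integral_dominated_convergence[where w = "\<lambda>t. \<bar>x t\<bar>"])
        show "AE t in leb_I. (\<lambda>K. \<bar>d K t\<bar>) \<longlonglongrightarrow> 0"
        proof (rule AE_I2)
          fix t assume t: "t \<in> space leb_I"
          have "eventually (\<lambda>K. \<bar>d K t\<bar> = 0) sequentially"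
            using eventually_gt_at_top[of "lx t"] by eventually_elim (simp add: d_eq[OF t])
          then show "(\<lambda>K. \<bar>d K t\<bar>) \<longlonglongrightarrow> 0" by (rule tendsto_eventually)
        qed
        show "AE t in leb_I. norm \<bar>d K t\<bar> \<le> \<bar>x t\<bar>" for K
          by (rule AE_I2) (simp add: d_eq)
      qed (use xint d_int in auto)
      then have "(\<lambda>K. M * (r * I m) + M * (\<integral>t. \<bar>d K t\<bar> \<partial>leb_I)) \<longlonglongrightarrow> M * (r * I m) + M * 0"
        by (intro tendsto_intros) simp
      then show ?thesis using le by (intro LIMSEQ_le_const[where a="\<integral>t. h m t * y t \<partial>leb_I"]) auto
    qed
    have "(\<lambda>t. b (ly t) / (r^2 * M)) \<in> C"
    proof (rule block_average[OF moved ly])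
      show "0 \<le> b m / (r^2 * M)" for m using b M by simp
      fix m
      show "b m / (r^2 * M) * measure leb_I {t\<in>space leb_I. ly t = m}
          \<le> (\<integral>t\<in>{t\<in>space leb_I. ly t = m}. a (\<sigma> t) / r \<partial>leb_I)"
      proof -
        have yB_int: "integrable leb_I (\<lambda>t. h m t * y t)" by (rule hf_int[OF yint])
        have "b m * measure leb_I (B m) = (\<integral>t. indicat_real (B m) t * b m \<partial>leb_I)"
          using sets.sets_into_space[OF B] by (simp add: Int_absorb2)
        also have "\<dots> \<le> (\<integral>t. r * (h m t * y t) \<partial>leb_I)"
        proof (rule integral_mono)
          show "integrable leb_I (\<lambda>t. indicat_real (B m) t * b m)"
            by (intro integrable_mult_left integrable_real_indicator B) (simp add: leb.emeasure_eq_measure)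
          show "integrable leb_I (\<lambda>t. r * (h m t * y t))" using yB_int by simp
          fix t
          show "indicat_real (B m) t * b m \<le> r * (h m t * y t)"
            using b(4)[of t] by (auto simp: h_def B_def indicator_def abs_sgn mult_ac)
        qed
        also have "\<dots> = r * (\<integral>t. h m t * y t \<partial>leb_I)" by simp
        also have "\<dots> \<le> r * (M * (r * I m))" using h_y r by (intro mult_left_mono) auto
        finally have "b m * measure leb_I (B m) \<le> I m * (r^2 * M)"
          by (simp add: power2_eq_square mult_ac)
        then have "b m / (r^2 * M) * measure leb_I (B m) \<le> I m"
          using M r by (simp add: pos_divide_le_eq)
        then show ?thesis by (simp add: I_def B_def)
      qed
    qed
    then show ?thesis
      by (rule solid) (use order_trans[OF b(3) abs_ge_self] M in \<open>auto intro!: divide_right_mono\<close>)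
  qed
  show ?thesis
  proof (rule slack)
    show "(\<lambda>t. T x t / M) \<in> borel_measurable leb_I" using ymeas by (simp add: y_def)
    fix s :: real assume s: "0 < s" "s < 1"
    define r where "r = 1 / sqrt s"
    have "1 < r" using s by (simp add: r_def)
    from main[OF this] have "(\<lambda>t. y t / (r^2 * M)) \<in> C" .
    also have "(\<lambda>t. y t / (r^2 * M)) = (\<lambda>t. s * (T x t / M))"
      using s by (simp add: r_def y_def power_divide mult.commute)
    finally show "(\<lambda>t. s * (T x t / M)) \<in> C" .
  qed
qed

end

section \<open>Majorant ideals\<close>

lemma function_ideal_scale:
  "\<lbrakk>function_ideal X; x \<in> X\<rbrakk> \<Longrightarrow> (\<lambda>t. c * x t) \<in> X"
  by (simp add: function_ideal_def)

lemma averaging_stable_ideal: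
  assumes X: "function_ideal X" and avg: "\<And>F. countable_partition F \<Longrightarrow> averages F X"
  shows "averaging_stable X"
proof
  show "integrable leb_I x" if "x \<in> X" for x
    using X that by (auto simp: function_ideal_def L1_def)
  show "y \<in> X" if "x \<in> X" "y \<in> borel_measurable leb_I" "AE t in leb_I. \<bar>y t\<bar> \<le> \<bar>x t\<bar>" for x y
    using X that by (auto simp: function_ideal_def)
  show "real_cond_exp leb_I F x \<in> X" if "x \<in> X" "countable_partition F" for x F
    using avg[OF that(2)] that(1) by (auto simp: averages_def)
  show "y \<in> X" if "\<And>r. 0 < r \<Longrightarrow> r < 1 \<Longrightarrow> (\<lambda>t. r * y t) \<in> X" for y
    using function_ideal_scale[OF X that[of "1/2"], of 2] by simp
qed

lemma majorant_of_averaging: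
  assumes X: "function_ideal X" and avg: "\<And>F. countable_partition F \<Longrightarrow> averages F X"
  shows "majorant_ideal X"
  unfolding majorant_ideal_def
proof (intro conjI X allI impI subsetI)
  fix T y assume T: "L1_Linf_operator T" and "y \<in> T ` X"
  then obtain x where x: "x \<in> X" and y: "y = T x" by auto
  interpret averaging_stable X by (rule averaging_stable_ideal[OF X avg])
  have lin: "linear_L1 T" and fin: "op_norm L1 L1_norm T < \<infinity>" and TLinf: "T ` Linf \<subseteq> Linf"
    using T by (auto simp: L1_Linf_operator_def bounded_linear_L1_def)
  define c where "c = enn2real (op_norm L1 L1_norm T)"
  have c: "0 \<le> c" "op_norm L1 L1_norm T \<le> ennreal c"
    using fin by (auto simp: c_def)
  note T1 = L1_operator_bound[OF lin c]
  obtain M where M: "0 < M"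
    and Tinf: "\<And>f. f \<in> borel_measurable leb_I \<Longrightarrow> AE t in leb_I. \<bar>f t\<bar> \<le> 1 \<Longrightarrow> AE t in leb_I. \<bar>T f t\<bar> \<le> M"
    using automatic_Linf_bound[OF lin c(1) T1 TLinf] by blast
  define K where "K = max c M"
  have "(\<lambda>t. T x t / K) \<in> X"
  proof (rule operator_image[OF lin _ _ _ x])
    show K: "0 < K" using M by (simp add: K_def)
    fix f :: fn
    show "(\<integral>t. \<bar>T f t\<bar> \<partial>leb_I) \<le> K * (\<integral>t. \<bar>f t\<bar> \<partial>leb_I)" if "integrable leb_I f"
    proof (rule order_trans[OF T1[OF that]])
      show "c * (\<integral>t. \<bar>f t\<bar> \<partial>leb_I) \<le> K * (\<integral>t. \<bar>f t\<bar> \<partial>leb_I)"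
        by (intro mult_right_mono) (auto simp: K_def)
    qed
    show "AE t in leb_I. \<bar>T f t\<bar> \<le> K"
      if "f \<in> borel_measurable leb_I" "AE t in leb_I. \<bar>f t\<bar> \<le> 1"
      using Tinf[OF that] by eventually_elim (simp add: K_def)
  qed
  from function_ideal_scale[OF X this, of K] show "y \<in> X"
    using M by (simp add: y K_def)
qed

lemma cond_exp_contractive:
  assumes B: "banach_ideal X N" and F: "countable_partition F" and avg: "averages F X"
    and le: "op_norm X (\<lambda>x. ennreal (N x)) (real_cond_exp leb_I F) \<le> 1"
    and z: "z \<in> X"
  shows "N (real_cond_exp leb_I F z) \<le> N z"
proof -
  interpret F: finite_measure_subalgebra leb_I F by (rule countable_partition_subalgebra[OF F])
  have X: "function_ideal X" and N: "norm_on X N"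
    and mono: "\<And>x y. \<lbrakk>x \<in> X; y \<in> X; AE t in leb_I. \<bar>y t\<bar> \<le> \<bar>x t\<bar>\<rbrakk> \<Longrightarrow> N y \<le> N x"
    using B by (auto simp: banach_ideal_def)
  have N0: "0 \<le> N z" and Nzero: "\<And>x. x \<in> X \<Longrightarrow> N x = 0 \<longleftrightarrow> (AE t in leb_I. x t = 0)"
    and Nscale: "\<And>x c. x \<in> X \<Longrightarrow> N (\<lambda>t. c * x t) = \<bar>c\<bar> * N x"
    using N z by (auto simp: norm_on_def)
  have EX: "real_cond_exp leb_I F x \<in> X" if "x \<in> X" for x
    using avg that by (auto simp: averages_def)
  have z_int: "integrable leb_I z" using X z by (auto simp: function_ideal_def L1_def)
  show ?thesis
  proof (cases "N z = 0")
    case True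
    then have "AE t in leb_I. z t = 0 * z t" using Nzero[OF z] by simp
    then have "AE t in leb_I. real_cond_exp leb_I F z t = real_cond_exp leb_I F (\<lambda>s. 0 * z s) t"
      using z_int by (intro F.real_cond_exp_cong) auto
    with F.real_cond_exp_cmult[OF z_int, of 0] have "AE t in leb_I. real_cond_exp leb_I F z t = 0"
      by eventually_elim simp
    then show ?thesis using True Nzero[OF EX[OF z]] by simp
  next
    case False
    then have pos: "0 < N z" using N0 by simp
    define u where "u = (\<lambda>t. (1 / N z) * z t)"
    have u: "u \<in> X" unfolding u_def by (rule function_ideal_scale[OF X z])
    have "N u = 1" using Nscale[OF z, of "1 / N z"] pos by (simp add: u_def)
    then have "ennreal (N (real_cond_exp leb_I F u)) \<le> op_norm X (\<lambda>x. ennreal (N x)) (real_cond_exp leb_I F)"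
      unfolding op_norm_def using u by (intro SUP_upper) auto
    then have "ennreal (N (real_cond_exp leb_I F u)) \<le> 1" using le by (rule order_trans)
    then have Eu: "N (real_cond_exp leb_I F u) \<le> 1"
      by (simp add: ennreal_le_1)
    have "N (\<lambda>t. (1 / N z) * real_cond_exp leb_I F z t) \<le> N (real_cond_exp leb_I F u)"
    proof (rule mono[OF EX[OF u] function_ideal_scale[OF X EX[OF z]]])
      show "AE t in leb_I. \<bar>1 / N z * real_cond_exp leb_I F z t\<bar> \<le> \<bar>real_cond_exp leb_I F u t\<bar>"
        using F.real_cond_exp_cmult[OF z_int, of "1 / N z"] unfolding u_def
        by eventually_elim simp
    qed
    also have "N (\<lambda>t. (1 / N z) * real_cond_exp leb_I F z t) = (1 / N z) * N (real_cond_exp leb_I F z)"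
      using Nscale[OF EX[OF z], of "1 / N z"] pos by simp
    finally have "(1 / N z) * N (real_cond_exp leb_I F z) \<le> 1" using Eu by (rule order_trans)
    then show ?thesis using pos by (simp add: field_simps)
  qed
qed

lemma averaging_stable_ball:
  assumes B: "banach_ideal X N" and avg: "\<And>F. countable_partition F \<Longrightarrow> averages F X"
    and le: "\<And>F. countable_partition F \<Longrightarrow> op_norm X (\<lambda>x. ennreal (N x)) (real_cond_exp leb_I F) \<le> 1"
  shows "averaging_stable {z\<in>X. N z \<le> c}"
proof -
  have X: "function_ideal X" and N: "norm_on X N"
    and mono: "\<And>x y. \<lbrakk>x \<in> X; y \<in> X; AE t in leb_I. \<bar>y t\<bar> \<le> \<bar>x t\<bar>\<rbrakk> \<Longrightarrow> N y \<le> N x"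
    using B by (auto simp: banach_ideal_def)
  interpret X: averaging_stable X by (rule averaging_stable_ideal[OF X avg])
  show ?thesis
  proof
    show "integrable leb_I x" if "x \<in> {z\<in>X. N z \<le> c}" for x
      using that X.integrable by auto
    show "y \<in> {z\<in>X. N z \<le> c}"
      if "x \<in> {z\<in>X. N z \<le> c}" "y \<in> borel_measurable leb_I" "AE t in leb_I. \<bar>y t\<bar> \<le> \<bar>x t\<bar>" for x y
      using that X.solid[of x y] mono[of x y] by auto
    show "real_cond_exp leb_I F x \<in> {z\<in>X. N z \<le> c}"
      if "x \<in> {z\<in>X. N z \<le> c}" "countable_partition F" for x F
      using that X.avg[of x F] cond_exp_contractive[OF B that(2) avg[OF that(2)] le[OF that(2)], of x] by auto
    show "y \<in> {z\<in>X. N z \<le> c}"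
      if y: "y \<in> borel_measurable leb_I"
        and r: "\<And>r. 0 < r \<Longrightarrow> r < 1 \<Longrightarrow> (\<lambda>t. r * y t) \<in> {z\<in>X. N z \<le> c}" for y
    proof -
      have yX: "y \<in> X" by (rule X.slack[OF y]) (use r in auto)
      have "r * N y \<le> c" if "0 < r" "r < 1" for r
        using r[OF that] N yX that by (auto simp: norm_on_def)
      then have "N y \<le> c" by (rule field_le_mult_one_interval)
      then show ?thesis using yX by simp
    qed
  qed
qed

text \<open>
  For any real \<open>K\<close> above both operator norms, the set of \<open>z\<close> with \<open>N z \<le> N x\<close> contains \<open>T x / K\<close> together
  with \<open>x\<close>. If one of the norms is infinite there is nothing to prove.
\<close>

lemma strongly_majorant_of_averaging:
  assumes B: "banach_ideal X N" and avg: "\<And>F. countable_partition F \<Longrightarrow> averages F X"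
    and le: "\<And>F. countable_partition F \<Longrightarrow> op_norm X (\<lambda>x. ennreal (N x)) (real_cond_exp leb_I F) \<le> 1"
  shows "strongly_majorant_ideal X N"
  unfolding strongly_majorant_ideal_def
proof (intro conjI B allI impI)
  have X: "function_ideal X" and N: "norm_on X N"
    using B by (auto simp: banach_ideal_def)
  show maj: "majorant_ideal X" by (rule majorant_of_averaging[OF X avg])
  fix T assume T: "L1_Linf_operator T"
  then have lin: "linear_L1 T" by (auto simp: L1_Linf_operator_def bounded_linear_L1_def)
  let ?m = "max (op_norm L1 L1_norm T) (op_norm Linf Linf_norm T)"
  show "op_norm X (\<lambda>x. ennreal (N x)) T \<le> ?m"
    unfolding op_norm_def[of X]
  proof (rule SUP_least)
    fix x assume "x \<in> {f \<in> X. ennreal (N f) \<le> 1}"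
    then have x: "x \<in> X" "N x \<le> 1" by (auto simp: ennreal_le_1)
    show "ennreal (N (T x)) \<le> ?m"
    \<comment> \<open>Passing to a larger \<open>e\<close> covers the case that both operator norms vanish.\<close>
    proof (rule dense_ge)
      fix e assume e: "?m < e"
      show "ennreal (N (T x)) \<le> e"
      proof (cases "e = \<infinity>")
        case True
        then show ?thesis by simp
      next
        case False
        define K where "K = enn2real e"
        have eK: "e = ennreal K" using False by (simp add: K_def ennreal_enn2real_if)
        have "0 < e" using e by (rule order_le_less_trans[rotated]) simp
        then have K: "0 < K" using eK by (simp add: ennreal_less_zero_iff)
        interpret averaging_stable "{z\<in>X. N z \<le> N x}"
          by (rule averaging_stable_ball[OF B avg le])
        have "(\<lambda>t. T x t / K) \<in> {z\<in>X. N z \<le> N x}"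
        proof (rule operator_image[OF lin K])
          show "(\<integral>t. \<bar>T f t\<bar> \<partial>leb_I) \<le> K * (\<integral>t. \<bar>f t\<bar> \<partial>leb_I)" if "integrable leb_I f" for f
            using L1_operator_bound[OF lin _ _ that, of K] e K unfolding eK by (simp add: less_imp_le)
          show "AE t in leb_I. \<bar>T f t\<bar> \<le> K"
            if "f \<in> borel_measurable leb_I" "AE t in leb_I. \<bar>f t\<bar> \<le> 1" for f
            using Linf_operator_bound[OF _ _ that, of K T] e K unfolding eK by (simp add: less_imp_le)
        qed (use x in simp)
        then have le1: "N (\<lambda>t. T x t / K) \<le> 1" using x by simp
        have "T x \<in> X" using maj T x(1) by (auto simp: majorant_ideal_def)
        then have "N (\<lambda>t. (1 / K) * T x t) = \<bar>1 / K\<bar> * N (T x)"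
          using N by (simp only: norm_on_def)
        then have "N (\<lambda>t. T x t / K) = N (T x) / K" using K by simp
        with le1 have "N (T x) / K \<le> 1" by (simp only:)
        then have "N (T x) \<le> K" using K by simp
        then show ?thesis unfolding eK by (rule ennreal_leI)
      qed
    qed
  qed
qed

theorem theorem3p2:
  fixes X :: "(real \<Rightarrow> real) set"
  assumes "\<forall>F. countable_partition F \<longrightarrow> averages F X"
  shows "(function_ideal X \<longrightarrow> (\<forall>x\<in>X. orbit x \<subseteq> X) \<and> majorant_ideal X) \<and>
    (\<forall>N :: (real \<Rightarrow> real) \<Rightarrow> real.
       banach_ideal X N \<and>
       (\<forall>F. countable_partition F \<longrightarrow>
          op_norm X (\<lambda>x. ennreal (N x)) (real_cond_exp leb_I F) \<le> 1) \<longrightarrow>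
       strongly_majorant_ideal X N)"
proof (intro conjI impI allI)
  assume "function_ideal X"
  then have maj: "majorant_ideal X" using assms by (intro majorant_of_averaging) auto
  then show "(\<forall>x\<in>X. orbit x \<subseteq> X)" using orbit_subset by blast
  show "majorant_ideal X" by (rule maj)
next
  fix N :: "(real \<Rightarrow> real) \<Rightarrow> real"
  assume "banach_ideal X N \<and>
       (\<forall>F. countable_partition F \<longrightarrow>
          op_norm X (\<lambda>x. ennreal (N x)) (real_cond_exp leb_I F) \<le> 1)"
  then show "strongly_majorant_ideal X N"
    using assms by (intro strongly_majorant_of_averaging) auto
qed

end
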